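(* Let $\{U,T\}$ be a unitary representation of $BS(1,2)$ on a Hilbert space $H$ (i.e. $U,T$ unitary on $H$ with $UTU^{-1}=T^2$), and let $\psi\in H$ be a Parseval wavelet for $\{U,T\}$. Then there exist a Hilbert space $H_2$, a unitary representation $\{U_2,T_2\}$ of $BS(1,2)$ on $H_2$, and a Parseval wavelet $\psi_2$ for $\{U_2,T_2\}$ such that $\psi\oplus\psi_2$ is an orthonormal wavelet for the representation $\{U\oplus U_2,\,T\oplus T_2\}$ of $BS(1,2)$ on $H\oplus H_2$.
   Context: $BS(1,2)=\langle u,t\mid utu^{-1}=t^2\rangle$; a unitary representation of it on a Hilbert space is a pair of unitary operators $U,T$ with $UTU^{-1}=T^2$. A vector $\psi$ is a Parseval wavelet (resp. orthonormal wavelet) for $\{U,T\}$ on $H$ if $\{U^jT^k\psi\mid j,k\in\mathbb{Z}\}$ is a Parseval frame (resp. orthonormal basis) for $H$; a Parseval frame is a family $(e_i)$ with $\|f\|^2=\sum_i|\langle f,e_i\rangle|^2$ for all $f\in H$. *)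

theory Defs
  imports "HOL-Analysis.Analysis"
begin

text \<open>The library has no complex Hilbert spaces, so a complex Hilbert space is given
explicitly as a carrier set together with its vector operations and inner product
(linear in the first argument, conjugate-linear in the second).\<close>

record 'v chs =
  hcarrier :: "'v set"
  hadd :: "'v \<Rightarrow> 'v \<Rightarrow> 'v"
  hscale :: "complex \<Rightarrow> 'v \<Rightarrow> 'v"
  hzero :: "'v"
  hip :: "'v \<Rightarrow> 'v \<Rightarrow> complex"

definition hdiff :: "'v chs \<Rightarrow> 'v \<Rightarrow> 'v \<Rightarrow> 'v" where
  "hdiff H x y = hadd H x (hscale H (-1) y)"

definition hnorm :: "'v chs \<Rightarrow> 'v \<Rightarrow> real" where
  "hnorm H x = sqrt (Re (hip H x x))"

definition complex_hilbert_space :: "'v chs \<Rightarrow> bool" where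
  "complex_hilbert_space H \<longleftrightarrow>
     \<comment> \<open>complex vector space\<close>
     hzero H \<in> hcarrier H \<and>
     (\<forall>x\<in>hcarrier H. \<forall>y\<in>hcarrier H. hadd H x y \<in> hcarrier H) \<and>
     (\<forall>a. \<forall>x\<in>hcarrier H. hscale H a x \<in> hcarrier H) \<and>
     (\<forall>x\<in>hcarrier H. \<forall>y\<in>hcarrier H. \<forall>z\<in>hcarrier H.
        hadd H (hadd H x y) z = hadd H x (hadd H y z)) \<and>
     (\<forall>x\<in>hcarrier H. \<forall>y\<in>hcarrier H. hadd H x y = hadd H y x) \<and>
     (\<forall>x\<in>hcarrier H. hadd H x (hzero H) = x) \<and>
     (\<forall>x\<in>hcarrier H. \<exists>y\<in>hcarrier H. hadd H x y = hzero H) \<and>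
     (\<forall>a. \<forall>x\<in>hcarrier H. \<forall>y\<in>hcarrier H.
        hscale H a (hadd H x y) = hadd H (hscale H a x) (hscale H a y)) \<and>
     (\<forall>a b. \<forall>x\<in>hcarrier H. hscale H (a + b) x = hadd H (hscale H a x) (hscale H b x)) \<and>
     (\<forall>a b. \<forall>x\<in>hcarrier H. hscale H (a * b) x = hscale H a (hscale H b x)) \<and>
     (\<forall>x\<in>hcarrier H. hscale H 1 x = x) \<and>
     \<comment> \<open>inner product\<close>
     (\<forall>x\<in>hcarrier H. \<forall>y\<in>hcarrier H. \<forall>z\<in>hcarrier H.
        hip H (hadd H x y) z = hip H x z + hip H y z) \<and>
     (\<forall>a. \<forall>x\<in>hcarrier H. \<forall>y\<in>hcarrier H. hip H (hscale H a x) y = a * hip H x y) \<and>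
     (\<forall>x\<in>hcarrier H. \<forall>y\<in>hcarrier H. hip H y x = cnj (hip H x y)) \<and>
     (\<forall>x\<in>hcarrier H. Im (hip H x x) = 0 \<and> Re (hip H x x) \<ge> 0) \<and>
     (\<forall>x\<in>hcarrier H. hip H x x = 0 \<longrightarrow> x = hzero H) \<and>
     \<comment> \<open>completeness w.r.t. the induced norm\<close>
     (\<forall>f :: nat \<Rightarrow> 'v. (\<forall>n. f n \<in> hcarrier H) \<and>
        (\<forall>e>0. \<exists>N. \<forall>m\<ge>N. \<forall>n\<ge>N. hnorm H (hdiff H (f m) (f n)) < e) \<longrightarrow>
        (\<exists>x\<in>hcarrier H. (\<lambda>n. hnorm H (hdiff H (f n) x)) \<longlonglongrightarrow> 0))"

definition hlinear :: "'v chs \<Rightarrow> ('v \<Rightarrow> 'v) \<Rightarrow> bool" where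
  "hlinear H A \<longleftrightarrow>
     (\<forall>x\<in>hcarrier H. \<forall>y\<in>hcarrier H. A (hadd H x y) = hadd H (A x) (A y)) \<and>
     (\<forall>a. \<forall>x\<in>hcarrier H. A (hscale H a x) = hscale H a (A x))"

definition unitary_op :: "'v chs \<Rightarrow> ('v \<Rightarrow> 'v) \<Rightarrow> bool" where
  "unitary_op H A \<longleftrightarrow> bij_betw A (hcarrier H) (hcarrier H) \<and> hlinear H A \<and>
     (\<forall>x\<in>hcarrier H. \<forall>y\<in>hcarrier H. hip H (A x) (A y) = hip H x y)"

definition opow :: "'v chs \<Rightarrow> ('v \<Rightarrow> 'v) \<Rightarrow> int \<Rightarrow> 'v \<Rightarrow> 'v" where
  "opow H A j = (if 0 \<le> j then A ^^ nat j else (inv_into (hcarrier H) A) ^^ nat (- j))"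

text \<open>Unitary representation of BS(1,2) = <u,t | u t u^-1 = t^2>.\<close>
definition bs12_rep :: "'v chs \<Rightarrow> ('v \<Rightarrow> 'v) \<Rightarrow> ('v \<Rightarrow> 'v) \<Rightarrow> bool" where
  "bs12_rep H U T \<longleftrightarrow> unitary_op H U \<and> unitary_op H T \<and>
     (\<forall>x\<in>hcarrier H. U (T (inv_into (hcarrier H) U x)) = T (T x))"

definition parseval_frame :: "'v chs \<Rightarrow> ('i \<Rightarrow> 'v) \<Rightarrow> bool" where
  "parseval_frame H e \<longleftrightarrow> (\<forall>i. e i \<in> hcarrier H) \<and>
     (\<forall>f\<in>hcarrier H. ((\<lambda>i. (cmod (hip H f (e i)))\<^sup>2) has_sum (hnorm H f)\<^sup>2) UNIV)"

definition orthonormal_basis :: "'v chs \<Rightarrow> ('i \<Rightarrow> 'v) \<Rightarrow> bool" where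
  "orthonormal_basis H e \<longleftrightarrow> (\<forall>i. e i \<in> hcarrier H) \<and>
     (\<forall>i j. hip H (e i) (e j) = (if i = j then 1 else 0)) \<and>
     (\<forall>f\<in>hcarrier H. (\<forall>i. hip H f (e i) = 0) \<longrightarrow> f = hzero H)"

definition wavelet_system :: "'v chs \<Rightarrow> ('v \<Rightarrow> 'v) \<Rightarrow> ('v \<Rightarrow> 'v) \<Rightarrow> 'v \<Rightarrow> int \<times> int \<Rightarrow> 'v" where
  "wavelet_system H U T \<psi> = (\<lambda>(j, k). opow H U j (opow H T k \<psi>))"

definition parseval_wavelet :: "'v chs \<Rightarrow> ('v \<Rightarrow> 'v) \<Rightarrow> ('v \<Rightarrow> 'v) \<Rightarrow> 'v \<Rightarrow> bool" where
  "parseval_wavelet H U T \<psi> \<longleftrightarrow> parseval_frame H (wavelet_system H U T \<psi>)"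

definition orthonormal_wavelet :: "'v chs \<Rightarrow> ('v \<Rightarrow> 'v) \<Rightarrow> ('v \<Rightarrow> 'v) \<Rightarrow> 'v \<Rightarrow> bool" where
  "orthonormal_wavelet H U T \<psi> \<longleftrightarrow> orthonormal_basis H (wavelet_system H U T \<psi>)"

definition hsum :: "'v chs \<Rightarrow> 'w chs \<Rightarrow> ('v \<times> 'w) chs" where
  "hsum H K = \<lparr> hcarrier = hcarrier H \<times> hcarrier K,
     hadd = (\<lambda>(x, y) (x', y'). (hadd H x x', hadd K y y')),
     hscale = (\<lambda>a (x, y). (hscale H a x, hscale K a y)),
     hzero = (hzero H, hzero K),
     hip = (\<lambda>(x, y) (x', y'). hip H x x' + hip K y y') \<rparr>"

definition opsum :: "('v \<Rightarrow> 'v) \<Rightarrow> ('w \<Rightarrow> 'w) \<Rightarrow> ('v \<times> 'w \<Rightarrow> 'v \<times> 'w)" where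
  "opsum A B = (\<lambda>(x, y). (A x, B y))"

end

(* The analysis operator Theta h = (<h, U^j T^k psi>)_(j,k) embeds H isometrically into
   l^2(Z x Z), where U becomes the shift (j, k) |-> (j + 1, k). It suffices to find a unitary A on
   l^2(Z x Z) that satisfies the BS(1,2) relation with the shift, restricts to T on the range of
   Theta and sends the basis vector d_(0,k) to d_(0,k+1): then l^2(Z x Z) = ran Theta + H2 with
   H2 the orthogonal complement of the range, and psi2 = d_(0,0) - Theta psi.

   These requirements, with the relation, fix A consistently on the closed span V0 of ran Theta
   and the d_(j,k) with j <= 0. Since V0 is contained in U V0, one extends A from U^n V0 to
   U^(n+1) V0 step by step: the relation prescribes A^2 there, and on the orthogonal complement of
   U^n V0 any unitary square root of the prescribed operator will do. The spaces U^n V0 exhaust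
   l^2(Z x Z).

   Hilbert spaces are treated as complete real inner product spaces with multiplication by i as an
   extra operator J; complex unitary then means real orthogonal and commuting with J. *)
theory Submission
  imports Defs "HOL-Computational_Algebra.Formal_Power_Series"
begin

section \<open>Orthogonal projections and densely defined isometries\<close>

text \<open>The obstacle is the levels j > 0. The restriction of A to U^n V0 is conjugate to U^-n A
  U^n on V0, a 2^n-th root of A. The data on V0 do not single out such a root, and a root chosen at
  one stage must leave U^(n+1) V0 invariant before the next stage can start. Hence the square root
  is built so that it commutes with every bounded complex linear operator commuting with the
  operator whose root is taken, in particular with the projections onto the old and the new space.
  The condition on d_(0,k) makes the orbit of d_(0,0) the whole standard basis. Since Theta psi is
  the orthogonal projection of d_(0,0) onto ran Theta, the orbits of Theta psi and of psi2 are the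
  projections of this basis onto the two summands, and an orthogonal projection turns an orthonormal
  basis into a Parseval frame of its range.\<close>

lemma isometry_inner:
  fixes A :: "'a::real_inner \<Rightarrow> 'b::real_inner"
  assumes "linear A" and "\<And>x. norm (A x) = norm x"
  shows "inner (A x) (A y) = inner x y"
proof -
  have "norm (A x + A y) = norm (x + y)"
    by (metis assms linear_add)
  then have "(norm (A x + A y))\<^sup>2 = (norm (x + y))\<^sup>2" by simp
  moreover have "(norm (A x))\<^sup>2 = (norm x)\<^sup>2" "(norm (A y))\<^sup>2 = (norm y)\<^sup>2"
    by (simp_all add: assms)
  ultimately show ?thesis
    by (simp add: power2_norm_eq_inner inner_add_left inner_add_right inner_commute)
qed

lemma subspace_closure:
  fixes S :: "'a::real_normed_vector set"
  assumes S: "subspace S"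
  shows "subspace (closure S)"
proof (rule subspaceI)
  show "0 \<in> closure S" using subspace_0[OF S] closure_subset by blast
next
  fix x y assume "x \<in> closure S" "y \<in> closure S"
  then obtain f g where "\<forall>n. f n \<in> S" "f \<longlonglongrightarrow> x" "\<forall>n. g n \<in> S" "g \<longlonglongrightarrow> y"
    unfolding closure_sequential by blast
  then show "x + y \<in> closure S"
    unfolding closure_sequential
    by (intro exI[of _ "\<lambda>n. f n + g n"]) (auto intro: tendsto_add subspace_add[OF S])
next
  fix c :: real and x assume "x \<in> closure S"
  then obtain f where "\<forall>n. f n \<in> S" "f \<longlonglongrightarrow> x"
    unfolding closure_sequential by blast
  then show "c *\<^sub>R x \<in> closure S"
    unfolding closure_sequential
    by (intro exI[of _ "\<lambda>n. c *\<^sub>R f n"]) (auto intro: tendsto_scaleR subspace_scale[OF S])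
qed

text \<open>A minimizing sequence is Cauchy by the parallelogram law: midpoints of its members stay
  in \<open>W\<close>, so their distance from \<open>x\<close> cannot drop below the
  infimum.\<close>

lemma exists_nearest_point:
  fixes W :: "'a::{real_inner,banach} set"
  assumes W: "subspace W" "closed W"
  shows "\<exists>w\<in>W. \<forall>v\<in>W. norm (x - w) \<le> norm (x - v)"
proof -
  define d where "d = (INF v\<in>W. (norm (x - v))\<^sup>2)"
  have ne: "W \<noteq> {}" using W(1) subspace_0 by blast
  have bdd: "bdd_below ((\<lambda>v. (norm (x - v))\<^sup>2) ` W)" by (rule bdd_belowI[of _ 0]) auto
  have dle: "d \<le> (norm (x - v))\<^sup>2" if "v \<in> W" for v
    unfolding d_def by (rule cINF_lower[OF bdd that])
  have "\<exists>v\<in>W. (norm (x - v))\<^sup>2 < d + 1 / real (Suc n)" for n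
  proof -
    have "d < d + 1 / real (Suc n)" by simp
    then show ?thesis unfolding d_def using cINF_less_iff[OF ne bdd] by blast
  qed
  then obtain v where v: "\<And>n. v n \<in> W" "\<And>n. (norm (x - v n))\<^sup>2 < d + 1 / real (Suc n)"
    by metis
  have par: "(norm (v m - v n))\<^sup>2 \<le> 2 * (1 / real (Suc m) + 1 / real (Suc n))" for m n
  proof -
    have mid: "(1/2) *\<^sub>R (v m + v n) \<in> W" by (intro subspace_scale subspace_add W v)
    have "(norm (v m - v n))\<^sup>2 + 4 * (norm (x - (1/2) *\<^sub>R (v m + v n)))\<^sup>2
        = 2 * (norm (x - v m))\<^sup>2 + 2 * (norm (x - v n))\<^sup>2"
      by (simp add: power2_norm_eq_inner inner_add_left inner_add_right inner_diff_left
          inner_diff_right inner_commute algebra_simps)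
    with dle[OF mid] v(2)[of m] v(2)[of n] show ?thesis by simp
  qed
  have "Cauchy v"
  proof (rule CauchyI)
    fix e :: real assume e: "0 < e"
    obtain N where N: "4 / e\<^sup>2 < real (Suc N)"
      by (meson reals_Archimedean2 less_trans of_nat_less_iff lessI)
    show "\<exists>M. \<forall>m\<ge>M. \<forall>n\<ge>M. norm (v m - v n) < e"
    proof (intro exI allI impI)
      fix m n assume mn: "N \<le> m" "N \<le> n"
      have "1 / real (Suc m) \<le> 1 / real (Suc N)" "1 / real (Suc n) \<le> 1 / real (Suc N)"
        using mn by (simp_all add: field_simps)
      with par[of m n] have "(norm (v m - v n))\<^sup>2 \<le> 4 / real (Suc N)" by simp
      also have "\<dots> < e\<^sup>2" using N e by (simp add: field_simps)
      finally show "norm (v m - v n) < e" using e power_less_imp_less_base by fastforce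
    qed
  qed
  then obtain w where w: "v \<longlonglongrightarrow> w" using Cauchy_convergent_iff convergent_def by blast
  have wW: "w \<in> W" using closed_sequentially[OF W(2) _ w] v(1) by blast
  have "(\<lambda>n. d + 1 / real (Suc n)) \<longlonglongrightarrow> d + 0"
    by (intro tendsto_add tendsto_const LIMSEQ_inverse_real_of_nat[unfolded inverse_eq_divide])
  moreover have "(\<lambda>n. (norm (x - v n))\<^sup>2) \<longlonglongrightarrow> (norm (x - w))\<^sup>2" by (intro tendsto_intros w)
  ultimately have "(norm (x - w))\<^sup>2 \<le> d + 0"
    using v(2) by (meson LIMSEQ_le less_imp_le)
  then have "norm (x - w) \<le> norm (x - u)" if "u \<in> W" for u
    by (intro power2_le_imp_le[OF order_trans[OF _ dle[OF that]] norm_ge_zero]) simp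
  with wW show ?thesis by blast
qed

lemma exists_orthogonal_decomposition:
  fixes W :: "'a::{real_inner,banach} set"
  assumes W: "subspace W" "closed W"
  shows "\<exists>w\<in>W. \<forall>v\<in>W. inner (x - w) v = 0"
proof -
  obtain w where w: "w \<in> W" "\<And>v. v \<in> W \<Longrightarrow> norm (x - w) \<le> norm (x - v)"
    using exists_nearest_point[OF W] by blast
  have "inner (x - w) v = 0" if v: "v \<in> W" for v
  proof (cases "v = 0")
    case False
    \<comment> \<open>\<open>c *\<^sub>R v\<close> is the component of \<open>x - w\<close> along
      \<open>v\<close>; removing it shortens \<open>x - w\<close> unless it is zero, which
      minimality of \<open>w\<close> enforces.\<close>
    define c where "c = inner (x - w) v / inner v v"
    have "w + c *\<^sub>R v \<in> W" by (intro subspace_add subspace_scale W w v)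
    then have "(norm (x - w))\<^sup>2 \<le> (norm (x - (w + c *\<^sub>R v)))\<^sup>2" using w(2) by simp
    also have "\<dots> = (norm (x - w))\<^sup>2 - 2 * c * inner (x - w) v + c\<^sup>2 * inner v v"
      by (simp add: power2_norm_eq_inner inner_add_left inner_add_right inner_diff_left
          inner_diff_right inner_commute algebra_simps power2_eq_square[of c])
    also have "\<dots> = (norm (x - w))\<^sup>2 - (inner (x - w) v)\<^sup>2 / inner v v"
      using False by (simp add: c_def power2_eq_square field_simps)
    finally have "(inner (x - w) v)\<^sup>2 / inner v v \<le> 0" by simp
    then show ?thesis using False
      by (metis inner_gt_zero_iff divide_le_0_iff not_less power2_less_eq_zero_iff)
  qed simp
  with w(1) show ?thesis by blast
qed

lemma closure_eq_UNIV_if_orthogonal_trivial: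
  fixes S :: "'a::{real_inner,banach} set"
  assumes "subspace S" and "\<And>y. (\<And>s. s \<in> S \<Longrightarrow> inner s y = 0) \<Longrightarrow> y = 0"
  shows "closure S = UNIV"
proof -
  have "x \<in> closure S" for x
  proof -
    obtain w where w: "w \<in> closure S" "\<And>v. v \<in> closure S \<Longrightarrow> inner (x - w) v = 0"
      using exists_orthogonal_decomposition[OF subspace_closure[OF assms(1)] closed_closure] by blast
    have "x - w = 0"
      by (rule assms(2)) (metis w(2) closure_subset inner_commute subsetD)
    with w(1) show ?thesis by simp
  qed
  then show ?thesis by blast
qed

text \<open>The vectors on which \<open>f\<close> and \<open>g\<close> agree form a closed subspace,
  which is everything once its orthogonal complement is trivial. Operator identities below are thus
  checked only on vectors where both sides are explicit.\<close>

lemma bounded_linear_eqI: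
  fixes f g :: "'a::{real_inner,banach} \<Rightarrow> 'b::real_normed_vector"
  assumes f: "bounded_linear f" and g: "bounded_linear g"
    and dense: "\<And>y. (\<And>x. f x = g x \<Longrightarrow> inner x y = 0) \<Longrightarrow> y = 0"
  shows "f x = g x"
proof -
  define K where "K = {x. f x = g x}"
  have "subspace K"
    using bounded_linear.linear[OF f] bounded_linear.linear[OF g]
    by (auto simp: K_def subspace_def linear_0 linear_add linear_scale)
  moreover have "closed K"
    unfolding K_def
    by (intro closed_Collect_eq linear_continuous_on f g)
  ultimately obtain w where w: "w \<in> K" "\<And>v. v \<in> K \<Longrightarrow> inner (x - w) v = 0"
    using exists_orthogonal_decomposition by blast
  have "x - w = 0"
  proof (rule dense)
    show "inner v (x - w) = 0" if "f v = g v" for v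
      using w(2)[of v] that by (simp add: K_def inner_commute)
  qed
  with w(1) show ?thesis by (simp add: K_def)
qed

section \<open>Unitary operators on a real inner product space with complex structure\<close>

locale complex_structure =
  fixes J :: "'a::{real_inner,banach} \<Rightarrow> 'a"
  assumes linear_J: "linear J"
    and J_J: "J (J x) = - x"
    and norm_J: "norm (J x) = norm x"
begin

definition unitary :: "('a \<Rightarrow> 'a) \<Rightarrow> bool" where
  "unitary A \<longleftrightarrow> linear A \<and> (\<forall>x. norm (A x) = norm x) \<and> surj A \<and> (\<forall>x. A (J x) = J (A x))"

lemma unitary_linear: "unitary A \<Longrightarrow> linear A"
  and unitary_norm: "unitary A \<Longrightarrow> norm (A x) = norm x"
  and unitary_surj: "unitary A \<Longrightarrow> surj A"
  and unitary_J: "unitary A \<Longrightarrow> A (J x) = J (A x)"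
  by (simp_all add: unitary_def)

lemma unitary_inner: "unitary A \<Longrightarrow> inner (A x) (A y) = inner x y"
  by (intro isometry_inner) (simp_all add: unitary_def)

lemma unitary_bij: "unitary A \<Longrightarrow> bij A"
  by (metis bij_def linear_injective_0 norm_eq_zero unitary_linear unitary_norm unitary_surj)

lemma unitary_inv_left [simp]: "unitary A \<Longrightarrow> inv A (A x) = x"
  by (meson unitary_bij bij_is_inj inv_f_f)

lemma unitary_inv_right [simp]: "unitary A \<Longrightarrow> A (inv A x) = x"
  by (meson unitary_surj surj_f_inv_f)

lemma unitary_bounded_linear: "unitary A \<Longrightarrow> bounded_linear A"
  by (intro bounded_linear_intro[of _ 1])
    (simp_all add: unitary_norm linear_add linear_scale unitary_linear)

lemma unitary_inv: "unitary A \<Longrightarrow> unitary (inv A)"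
  unfolding unitary_def[of "inv A"]
proof (intro conjI allI)
  assume A: "unitary A"
  show "linear (inv A)"
  proof (rule linearI)
    show "inv A (x + y) = inv A x + inv A y" for x y
      using linear_add[OF unitary_linear[OF A], of "inv A x" "inv A y"]
      by (metis A unitary_inv_left unitary_inv_right)
    show "inv A (c *\<^sub>R x) = c *\<^sub>R inv A x" for c x
      using linear_scale[OF unitary_linear[OF A], of c "inv A x"]
      by (metis A unitary_inv_left unitary_inv_right)
  qed
  show "norm (inv A x) = norm x" for x by (metis A unitary_inv_right unitary_norm)
  show "surj (inv A)" by (metis A unitary_inv_left surjI)
  show "inv A (J x) = J (inv A x)" for x
    by (metis A unitary_J unitary_inv_left unitary_inv_right)
qed

lemma unitary_compose: "unitary A \<Longrightarrow> unitary B \<Longrightarrow> unitary (\<lambda>x. A (B x))"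
  unfolding unitary_def[of "\<lambda>x. A (B x)"]
  by (intro conjI allI)
    (use linear_compose[of B A] comp_surj[of B A] in
      \<open>simp_all add: unitary_norm unitary_J unitary_linear unitary_surj comp_def\<close>)

lemma unitary_inner_inv: "unitary A \<Longrightarrow> inner (A x) y = inner x (inv A y)"
  by (metis unitary_inner unitary_inv_right)

text \<open>A graph is used because the maps to be extended are given on sums whose summands are not
  unique. No choice of summands is needed: \<open>iso\<close>, applied to the difference of two
  pairs with equal first component, makes the relation single valued. The closure of
  \<open>G\<close> is then the graph of the extension.\<close>

lemma unitary_from_dense_graph:
  assumes G: "subspace G"
    and iso: "\<And>a b. (a, b) \<in> G \<Longrightarrow> norm a = norm b"
    and inv_J: "\<And>a b. (a, b) \<in> G \<Longrightarrow> (J a, J b) \<in> G"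
    and dom: "\<And>y. (\<And>a b. (a, b) \<in> G \<Longrightarrow> inner a y = 0) \<Longrightarrow> y = 0"
    and ran: "\<And>y. (\<And>a b. (a, b) \<in> G \<Longrightarrow> inner b y = 0) \<Longrightarrow> y = 0"
  shows "\<exists>A. unitary A \<and> (\<forall>a b. (a, b) \<in> G \<longrightarrow> A a = b)"
proof -
  have cG: "subspace (closure G)" by (rule subspace_closure[OF G])
  have norm_cl: "norm a = norm b" if ab: "(a, b) \<in> closure G" for a b
  proof -
    obtain f where f: "\<forall>n. f n \<in> G" "f \<longlonglongrightarrow> (a, b)"
      using ab unfolding closure_sequential by blast
    have "norm (fst (f n)) = norm (snd (f n))" for n
      using iso[of "fst (f n)" "snd (f n)"] f(1) by simp
    then have "(\<lambda>n. norm (snd (f n))) \<longlonglongrightarrow> norm a"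
      using tendsto_norm[OF tendsto_fst[OF f(2)]] by simp
    moreover have "(\<lambda>n. norm (snd (f n))) \<longlonglongrightarrow> norm b"
      using tendsto_norm[OF tendsto_snd[OF f(2)]] by simp
    ultimately show ?thesis by (rule LIMSEQ_unique)
  qed
  have J_cl: "(J a, J b) \<in> closure G" if ab: "(a, b) \<in> closure G" for a b
  proof -
    have J: "bounded_linear J"
      by (intro bounded_linear_intro[of _ 1])
        (simp_all add: norm_J linear_add linear_scale linear_J)
    obtain f where f: "\<forall>n. f n \<in> G" "f \<longlonglongrightarrow> (a, b)"
      using ab unfolding closure_sequential by blast
    have "(\<lambda>n. J (fst (f n))) \<longlonglongrightarrow> J a" "(\<lambda>n. J (snd (f n))) \<longlonglongrightarrow> J b"
      using bounded_linear.tendsto[OF J tendsto_fst[OF f(2)]]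
        bounded_linear.tendsto[OF J tendsto_snd[OF f(2)]] by simp_all
    then have "(\<lambda>n. (J (fst (f n)), J (snd (f n)))) \<longlonglongrightarrow> (J a, J b)" by (rule tendsto_Pair)
    moreover have "(J (fst (f n)), J (snd (f n))) \<in> G" for n
      using inv_J[of "fst (f n)" "snd (f n)"] f(1) by simp
    ultimately show ?thesis unfolding closure_sequential
      by (intro exI[of _ "\<lambda>n. (J (fst (f n)), J (snd (f n)))"]) simp
  qed
  have sub: "subspace (fst ` G)" "subspace (snd ` G)"
    by (intro linear_subspace_image linear_fst linear_snd G)+
  have dense: "closure (fst ` G) = UNIV" "closure (snd ` G) = UNIV"
    by (intro closure_eq_UNIV_if_orthogonal_trivial sub dom ran; force)+
  \<comment> \<open>By \<open>iso\<close> on differences both component sequences have the same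
    mutual distances, so convergence of either one forces convergence of the other. This serves
    totality and surjectivity alike.\<close>
  have Cauchy_transfer: "Cauchy (\<lambda>n. snd (f n)) = Cauchy (\<lambda>n. fst (f n))"
    if f: "\<forall>n. f n \<in> G" for f
  proof -
    have "norm (snd (f m) - snd (f n)) = norm (fst (f m) - fst (f n))" for m n
      using iso[of "fst (f m) - fst (f n)" "snd (f m) - snd (f n)"]
        subspace_diff[OF G, of "f m" "f n"] f by (simp add: minus_prod_def)
    then show ?thesis by (simp add: Cauchy_iff)
  qed
  have ex: "\<exists>b. (a, b) \<in> closure G" for a
  proof -
    obtain g where g: "\<forall>n. g n \<in> fst ` G" "g \<longlonglongrightarrow> a"
      using closure_sequential[of a "fst ` G"] by (auto simp: dense)
    have "\<forall>n. \<exists>p. p \<in> G \<and> fst p = g n" using g(1) by force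
    then obtain f where "\<forall>n. f n \<in> G \<and> fst (f n) = g n" by (rule choice[THEN exE])
    with g(2) have f: "\<forall>n. f n \<in> G" "(\<lambda>n. fst (f n)) \<longlonglongrightarrow> a" by simp_all
    obtain b where b: "(\<lambda>n. snd (f n)) \<longlonglongrightarrow> b"
      using Cauchy_transfer[OF f(1)] LIMSEQ_imp_Cauchy[OF f(2)]
      by (auto simp: Cauchy_convergent_iff convergent_def)
    have "f \<longlonglongrightarrow> (a, b)" using tendsto_Pair[OF f(2) b] by simp
    then show ?thesis using f(1) unfolding closure_sequential by blast
  qed
  have onto: "\<exists>a. (a, b) \<in> closure G" for b
  proof -
    obtain g where g: "\<forall>n. g n \<in> snd ` G" "g \<longlonglongrightarrow> b"
      using closure_sequential[of b "snd ` G"] by (auto simp: dense)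
    have "\<forall>n. \<exists>p. p \<in> G \<and> snd p = g n" using g(1) by force
    then obtain f where "\<forall>n. f n \<in> G \<and> snd (f n) = g n" by (rule choice[THEN exE])
    with g(2) have f: "\<forall>n. f n \<in> G" "(\<lambda>n. snd (f n)) \<longlonglongrightarrow> b" by simp_all
    obtain a where a: "(\<lambda>n. fst (f n)) \<longlonglongrightarrow> a"
      using Cauchy_transfer[OF f(1)] LIMSEQ_imp_Cauchy[OF f(2)]
      by (auto simp: Cauchy_convergent_iff convergent_def)
    have "f \<longlonglongrightarrow> (a, b)" using tendsto_Pair[OF a f(2)] by simp
    then show ?thesis using f(1) unfolding closure_sequential by blast
  qed
  have uniq: "b = b'" if "(a, b) \<in> closure G" "(a, b') \<in> closure G" for a b b'
    using norm_cl[of "a - a" "b - b'"] subspace_diff[OF cG that] by simp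
  obtain A where A: "\<And>a. (a, A a) \<in> closure G" using ex by metis
  have A_eq: "A a = b" if "(a, b) \<in> closure G" for a b using uniq[OF A that] .
  have "unitary A"
    unfolding unitary_def
  proof (intro conjI allI)
    show "linear A"
    proof (rule linearI)
      show "A (x + y) = A x + A y" for x y
        using subspace_add[OF cG A[of x] A[of y]] by (intro A_eq) simp
      show "A (c *\<^sub>R x) = c *\<^sub>R A x" for c x
        using subspace_scale[OF cG A[of x], of c] by (intro A_eq) simp
    qed
    show "norm (A x) = norm x" for x using norm_cl[OF A] by simp
    show "surj A" using onto A_eq by (metis surjI surj_def)
    show "A (J x) = J (A x)" for x by (intro A_eq J_cl A)
  qed
  then show ?thesis using A_eq closure_subset[of G] by blast
qed

end

section \<open>Square roots of positive contractions\<close>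

text \<open>The Taylor coefficients of \<open>sqrt (1 - x)\<close>, which are absolutely summable.\<close>
definition sqrt_coeff :: "nat \<Rightarrow> real" where
  "sqrt_coeff n = (- 1) ^ n * ((1/2) gchoose n)"

lemma gbinomial_Suc_quotient:
  "((a::real) gchoose Suc n) = (a gchoose n) * (a - real n) / real (Suc n)"
  by (simp add: gbinomial_prod_rev field_simps)

lemma sqrt_coeff_Suc_nonpos: "sqrt_coeff (Suc n) \<le> 0"
proof (induction n)
  case (Suc n)
  have "sqrt_coeff (Suc (Suc n)) = sqrt_coeff (Suc n) * ((real n + 1/2) / (real n + 2))"
    unfolding sqrt_coeff_def gbinomial_Suc_quotient[of _ "Suc n"] by (simp add: field_simps)
  also have "\<dots> \<le> 0" by (rule mult_nonpos_nonneg[OF Suc.IH]) simp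
  finally show ?case .
qed (simp add: sqrt_coeff_def)

text \<open>The alternating partial sum of the binomials of a telescopes to a single term, the
  signed binomial of a - 1. For a = 1/2 that term is a product of nonnegative ratios.\<close>

lemma sum_sqrt_coeff_nonneg: "0 \<le> (\<Sum>k\<le>n. sqrt_coeff k)"
proof -
  have "0 \<le> (- 1) ^ n * ((- (1/2) :: real) gchoose n)"
  proof (induction n)
    case (Suc n)
    have "(- 1) ^ Suc n * ((- (1/2) :: real) gchoose Suc n)
        = (- 1) ^ n * ((- (1/2)) gchoose n) * ((real n + 1/2) / (real n + 1))"
      unfolding gbinomial_Suc_quotient by (simp add: field_simps)
    also have "\<dots> \<ge> 0" by (rule mult_nonneg_nonneg[OF Suc.IH]) simp
    finally show ?case .
  qed simp
  then show ?thesis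
    using gbinomial_sum_lower_neg[of "1/2::real" n] by (simp add: sqrt_coeff_def mult.commute)
qed

text \<open>Only the zeroth coefficient, 1, is positive, so the absolute partial sums are 2 minus
  the signed ones. Summability at the boundary of the disc of convergence is what allows operators
  of norm 1 to be inserted.\<close>

lemma summable_abs_sqrt_coeff: "summable (\<lambda>n. \<bar>sqrt_coeff n\<bar>)"
proof (rule bounded_imp_summable)
  show "(\<Sum>k\<le>n. \<bar>sqrt_coeff k\<bar>) \<le> 2" for n
  proof -
    have "\<bar>sqrt_coeff k\<bar> = (if k = 0 then 2 else 0) - sqrt_coeff k" for k
      using sqrt_coeff_Suc_nonpos by (cases k) (simp_all add: sqrt_coeff_def)
    then have "(\<Sum>k\<le>n. \<bar>sqrt_coeff k\<bar>) = 2 - (\<Sum>k\<le>n. sqrt_coeff k)"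
      by (simp add: sum_subtractf)
    with sum_sqrt_coeff_nonneg[of n] show ?thesis by simp
  qed
qed simp

lemma abs_summable_sqrt_coeff: "(\<lambda>n. norm (sqrt_coeff n)) summable_on UNIV"
  using summable_abs_sqrt_coeff by (simp add: summable_on_UNIV_nonneg_real_iff)

text \<open>The series squares to 1 - x: this is the Vandermonde identity for 1/2 + 1/2 = 1.\<close>

lemma sqrt_coeff_convolution:
  "(\<Sum>m\<le>k. sqrt_coeff m * sqrt_coeff (k - m)) = (if k = 0 then 1 else if k = 1 then - 1 else 0)"
proof -
  have "(\<Sum>m\<le>k. sqrt_coeff m * sqrt_coeff (k - m))
      = (\<Sum>m\<le>k. (- 1) ^ k * (((1/2) gchoose m) * ((1/2) gchoose (k - m))))"
    by (intro sum.cong) (simp_all add: sqrt_coeff_def power_add[symmetric] mult.assoc mult.left_commute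
        flip: power_add)
  also have "\<dots> = (- 1) ^ k * (real 1 gchoose k)"
    using gbinomial_Vandermonde[of "1/2::real" "1/2" k]
    by (simp add: sum_distrib_left[symmetric] atLeast0AtMost)
  also have "\<dots> = (- 1) ^ k * real (1 choose k)" by (simp only: binomial_gbinomial)
  also have "\<dots> = (if k = 0 then 1 else if k = 1 then - 1 else 0)"
    by (cases "k \<le> 1") (auto simp: le_Suc_eq)
  finally show ?thesis .
qed

text \<open>\<open>Q\<close> is the series of sqrt (1 - x) evaluated at \<open>B\<close>. Being a
  limit of polynomials in \<open>B\<close>, it inherits selfadjointness and commutes with whatever
  commutes with \<open>B\<close>; the latter is later passed on to square roots of
  unitaries.\<close>

lemma positive_contraction_sqrt:
  fixes B :: "'a::{real_inner,banach} \<Rightarrow> 'a"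
  assumes B: "bounded_linear B" and contraction: "\<And>x. norm (B x) \<le> norm x"
    and selfadjoint: "\<And>x y. inner (B x) y = inner x (B y)"
  shows "\<exists>Q. bounded_linear Q \<and> (\<forall>x. Q (Q x) = x - B x)
      \<and> (\<forall>x y. inner (Q x) y = inner x (Q y))
      \<and> (\<forall>C. bounded_linear C \<longrightarrow> (\<forall>x. C (B x) = B (C x)) \<longrightarrow> (\<forall>x. C (Q x) = Q (C x)))"
proof -
  define Q where "Q x = (\<Sum>\<^sub>\<infinity>n. sqrt_coeff n *\<^sub>R (B ^^ n) x)" for x
  have linear_pow: "linear (B ^^ n)" for n
  proof (induction n)
    case (Suc n)
    then show ?case using linear_compose[OF Suc bounded_linear.linear[OF B]] by (simp add: comp_def)
  qed (simp add: linear_id[unfolded id_def])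
  have pow_le: "norm ((B ^^ n) x) \<le> norm x" for n x
    by (induction n) (auto intro: order_trans[OF contraction])
  have bound: "norm (sqrt_coeff n *\<^sub>R (B ^^ n) x) \<le> \<bar>sqrt_coeff n\<bar> * norm x" for n x
    by (simp add: mult_left_mono pow_le)
  have bound_summable: "(\<lambda>n. \<bar>sqrt_coeff n\<bar> * norm x) summable_on UNIV" for x :: 'a
    using abs_summable_sqrt_coeff by (intro summable_on_cmult_left) simp
  have abs_summ: "(\<lambda>n. norm (sqrt_coeff n *\<^sub>R (B ^^ n) x)) summable_on UNIV" for x
    by (rule summable_on_comparison_test[OF bound_summable bound]) simp
  have summ: "(\<lambda>n. sqrt_coeff n *\<^sub>R (B ^^ n) x) summable_on UNIV" for x
    using Infinite_Sum.abs_summable_summable[OF abs_summ] .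
  then have has_sum_Q: "((\<lambda>n. sqrt_coeff n *\<^sub>R (B ^^ n) x) has_sum Q x) UNIV" for x
    unfolding Q_def by (rule has_sum_infsum)
  have "bounded_linear Q"
  proof (rule bounded_linear_intro)
    show "Q (x + y) = Q x + Q y" for x y
      using has_sum_add[OF has_sum_Q[of x] has_sum_Q[of y]]
      by (intro has_sum_unique[OF has_sum_Q])
        (simp add: linear_add[OF linear_pow] scaleR_add_right)
    show "Q (r *\<^sub>R x) = r *\<^sub>R Q x" for r x
      using has_sum_bounded_linear[OF bounded_linear_scaleR_right has_sum_Q[of x], of r]
      by (intro has_sum_unique[OF has_sum_Q])
        (simp add: linear_scale[OF linear_pow] mult.commute)
    show "norm (Q x) \<le> norm x * (\<Sum>\<^sub>\<infinity>n. \<bar>sqrt_coeff n\<bar>)" for x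
    proof -
      have "norm (Q x) \<le> (\<Sum>\<^sub>\<infinity>n. norm (sqrt_coeff n *\<^sub>R (B ^^ n) x))"
        unfolding Q_def by (rule norm_infsum_bound[OF abs_summ])
      also have "\<dots> \<le> (\<Sum>\<^sub>\<infinity>n. \<bar>sqrt_coeff n\<bar> * norm x)"
        by (rule infsum_mono[OF abs_summ bound_summable bound])
      also have "\<dots> = norm x * (\<Sum>\<^sub>\<infinity>n. \<bar>sqrt_coeff n\<bar>)"
        by (simp add: infsum_cmult_right' mult.commute[of _ "norm x"])
      finally show ?thesis .
    qed
  qed
  moreover have comm: "C (Q x) = Q (C x)"
    if C: "bounded_linear C" and CB: "\<forall>x. C (B x) = B (C x)" for C x
  proof -
    have "C ((B ^^ n) y) = (B ^^ n) (C y)" for n y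
      by (induction n) (simp_all add: CB)
    then show ?thesis
      using has_sum_bounded_linear[OF C has_sum_Q[of x]]
      by (intro has_sum_unique[OF _ has_sum_Q])
        (simp add: linear_scale[OF bounded_linear.linear[OF C]])
  qed
  moreover have "inner (Q x) y = inner x (Q y)" for x y
  proof -
    have "inner ((B ^^ n) x) y = inner x ((B ^^ n) y)" for n x y
      by (induction n arbitrary: y) (simp_all add: selfadjoint flip: funpow_swap1)
    then have "((\<lambda>n. inner x (sqrt_coeff n *\<^sub>R (B ^^ n) y)) has_sum inner (Q x) y) UNIV"
      using has_sum_bounded_linear[OF bounded_linear_inner_left has_sum_Q[of x], of y] by simp
    then show ?thesis
      using has_sum_bounded_linear[OF bounded_linear_inner_right has_sum_Q[of y], of x]
      by (rule has_sum_unique)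
  qed
  moreover have "Q (Q x) = x - B x" for x
  proof -
    \<comment> \<open>Cauchy product: absolute summability permits regrouping the double series
      along k = m + n, and the convolution identity leaves only the terms k = 0 and k = 1.\<close>
    define f where "f = (\<lambda>(m, n). (sqrt_coeff m * sqrt_coeff n) *\<^sub>R (B ^^ (m + n)) x)"
    have f_abs: "(\<lambda>p. norm (f p)) summable_on (UNIV \<times> UNIV)"
    proof (rule summable_on_comparison_test)
      have "(\<lambda>p. norm (case p of (m, n) \<Rightarrow> \<bar>sqrt_coeff m\<bar> * \<bar>sqrt_coeff n\<bar>)) summable_on (UNIV \<times> UNIV)"
        using abs_summable_sqrt_coeff unfolding Infinite_Sum.abs_summable_on_Sigma_iff
        by (auto simp: abs_mult infsum_cmult_right' intro!: summable_on_cmult_left summable_on_cmult_right)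
      then show "(\<lambda>p. (case p of (m, n) \<Rightarrow> \<bar>sqrt_coeff m\<bar> * \<bar>sqrt_coeff n\<bar>) * norm x)
          summable_on (UNIV \<times> UNIV)"
        by (rule summable_on_cmult_left[OF Infinite_Sum.abs_summable_summable])
      show "norm (f p) \<le> (case p of (m, n) \<Rightarrow> \<bar>sqrt_coeff m\<bar> * \<bar>sqrt_coeff n\<bar>) * norm x" for p
        by (cases p) (simp add: f_def abs_mult mult_left_mono pow_le)
    qed simp
    then have f_summ: "f summable_on (UNIV \<times> UNIV)" by (rule Infinite_Sum.abs_summable_summable)
    have "Q (Q x) = (\<Sum>\<^sub>\<infinity>m. \<Sum>\<^sub>\<infinity>n. f (m, n))"
      unfolding Q_def[of "Q x"]
    proof (rule infsum_cong)
      fix m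
      have "bounded_linear (\<lambda>y. sqrt_coeff m *\<^sub>R (B ^^ m) y)"
        using bound[of m] linear_pow[of m]
        by (intro bounded_linear_intro[of _ "\<bar>sqrt_coeff m\<bar>"])
          (simp_all add: linear_add linear_scale scaleR_add_right
            mult.commute[of _ "sqrt_coeff m"] mult.commute[of _ "\<bar>sqrt_coeff m\<bar>"])
      from has_sum_bounded_linear[OF this has_sum_Q[of x]]
      have "((\<lambda>n. f (m, n)) has_sum sqrt_coeff m *\<^sub>R (B ^^ m) (Q x)) UNIV"
        by (simp add: f_def linear_scale[OF linear_pow] funpow_add)
      then show "sqrt_coeff m *\<^sub>R (B ^^ m) (Q x) = (\<Sum>\<^sub>\<infinity>n. f (m, n))"
        by (simp add: infsumI)
    qed
    also have "\<dots> = infsum f (UNIV \<times> UNIV)"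
      by (rule infsum_Sigma_banach[OF f_summ])
    also have "\<dots> = infsum (\<lambda>p. f (case p of (k, m) \<Rightarrow> (m, k - m))) (SIGMA k:UNIV. {..k})"
    proof (rule infsum_reindex_bij_betw[symmetric])
      show "bij_betw (\<lambda>(k, m). (m, k - m)) (SIGMA k:UNIV. {..k}) (UNIV \<times> UNIV :: (nat \<times> nat) set)"
        by (rule bij_betwI[of _ _ _ "\<lambda>(m, n). (m + n, m)"]) auto
    qed
    also have "\<dots> = (\<Sum>\<^sub>\<infinity>k. \<Sum>\<^sub>\<infinity>m\<in>{..k}. f (m, k - m))"
    proof -
      have "(\<lambda>p. f (case p of (k, m) \<Rightarrow> (m, k - m))) summable_on (SIGMA k:UNIV. {..k})"
        using f_summ
        by (subst summable_on_reindex_bij_betw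
            [OF bij_betwI[of _ _ "UNIV \<times> UNIV" "\<lambda>(m, n). (m + n, m)"]]) auto
      from infsum_Sigma_banach[OF this] show ?thesis by simp
    qed
    also have "\<dots> = (\<Sum>\<^sub>\<infinity>k. (if k = 0 then 1 else if k = 1 then - 1 else 0) *\<^sub>R (B ^^ k) x)"
    proof (rule infsum_cong)
      fix k :: nat
      have "(\<Sum>\<^sub>\<infinity>m\<in>{..k}. f (m, k - m)) = (\<Sum>m\<le>k. (sqrt_coeff m * sqrt_coeff (k - m)) *\<^sub>R (B ^^ k) x)"
        by (simp add: f_def)
      then show "(\<Sum>\<^sub>\<infinity>m\<in>{..k}. f (m, k - m))
          = (if k = 0 then 1 else if k = 1 then - 1 else 0) *\<^sub>R (B ^^ k) x"
        by (simp only: scaleR_sum_left[symmetric] sqrt_coeff_convolution)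
    qed
    also have "\<dots> = (\<Sum>\<^sub>\<infinity>k\<in>{0, 1}. (if k = 0 then 1 else if k = 1 then - 1 else 0) *\<^sub>R (B ^^ k) x)"
      by (rule infsum_cong_neutral) auto
    also have "\<dots> = x - B x" by simp
    finally show ?thesis .
  qed
  ultimately show ?thesis by blast
qed

section \<open>Square roots of unitary operators\<close>

context complex_structure
begin

lemma bounded_linear_J: "bounded_linear J"
  by (intro bounded_linear_intro[of _ 1]) (simp_all add: norm_J linear_add linear_scale linear_J)

text \<open>If \<open>S\<close> is multiplication by \<open>exp (i \<theta>)\<close> with \<open>-\<pi> < \<theta> \<le> \<pi>\<close>, then
  \<open>B = (2 - S - inv S) / 4\<close> is \<open>sin\<^sup>2 (\<theta>/2)\<close> and \<open>Q = sqrt (1 - B)\<close> is \<open>cos (\<theta>/2)\<close>, so the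
  operator \<open>exp (i \<theta>/2)\<close> sends \<open>Q x\<close> to \<open>(x + S x) / 2\<close>; on the eigenspace of \<open>-1\<close>, where
  \<open>Q\<close> vanishes, it is \<open>J\<close>.\<close>
lemma unitary_sqrt:
  assumes S: "unitary S"
  shows "\<exists>R. unitary R \<and> (\<forall>x. R (R x) = S x) \<and>
    (\<forall>C. bounded_linear C \<longrightarrow> (\<forall>x. C (J x) = J (C x)) \<longrightarrow> (\<forall>x. C (S x) = S (C x))
      \<longrightarrow> (\<forall>x. C (R x) = R (C x)))"
proof -
  define B where "B x = (1/4) *\<^sub>R (2 *\<^sub>R x - S x - inv S x)" for x
  note lin = unitary_linear[OF S] unitary_linear[OF unitary_inv[OF S]] linear_J
  note lins = lin[THEN linear_add] lin[THEN linear_scale] lin[THEN linear_diff] lin[THEN linear_neg]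
  have blS: "bounded_linear S" and blS': "bounded_linear (inv S)"
    using S unitary_inv unitary_bounded_linear by blast+
  have "bounded_linear (\<lambda>x. 2 *\<^sub>R x - S x - inv S x)"
    by (intro bounded_linear_sub bounded_linear_scaleR_right blS blS')
  then have "bounded_linear B"
    using bounded_linear_compose[OF bounded_linear_scaleR_right] unfolding B_def[abs_def] by blast
  moreover have "norm (B x) \<le> norm x" for x
  proof -
    have "norm (2 *\<^sub>R x - S x - inv S x) \<le> norm (2 *\<^sub>R x) + norm (S x) + norm (inv S x)"
      by (meson add_mono norm_triangle_ineq4 order_refl order_trans)
    then show ?thesis
      by (simp add: B_def unitary_norm S unitary_inv)
  qed
  moreover have S_adj: "inner (S x) y = inner x (inv S y)" "inner (inv S x) y = inner x (S y)" for x y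
    using unitary_inner_inv[OF S, of x y] unitary_inner_inv[OF S, of y x] by (simp_all add: inner_commute)
  then have "inner (B x) y = inner x (B y)" for x y
    by (simp add: B_def inner_diff_left inner_diff_right)
  ultimately obtain Q where blQ: "bounded_linear Q" and QQ: "\<And>x. Q (Q x) = x - B x"
    and Q_adj: "\<And>x y. inner (Q x) y = inner x (Q y)"
    and Q_comm: "\<And>C x. bounded_linear C \<Longrightarrow> (\<forall>x. C (B x) = B (C x)) \<Longrightarrow> C (Q x) = Q (C x)"
    using positive_contraction_sqrt[of B] by blast
  note linQ = bounded_linear.linear[OF blQ]
  have comm_B: "C (B x) = B (C x)"
    if C: "bounded_linear C" "\<forall>x. C (S x) = S (C x)" for C x
  proof -
    have "C (inv S x) = inv S (C x)" by (metis C(2) S unitary_inv_left unitary_inv_right)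
    then show ?thesis using C
      by (simp add: B_def linear_scale linear_diff bounded_linear.linear)
  qed
  have QS: "Q (S x) = S (Q x)" for x using Q_comm[of S] comm_B[OF blS] by (simp add: blS)
  have QJ: "Q (J x) = J (Q x)" for x
    using Q_comm[of J] comm_B[OF bounded_linear_J] unitary_J[OF S] by (simp add: bounded_linear_J)
  \<comment> \<open>\<open>Q\<close> squared is (2 + S + inv S) / 4, which is also the adjoint of (1
    + S) / 2 times (1 + S) / 2. So sending \<open>Q x\<close> to half of \<open>x + S x\<close> is
    isometric, and the kernel of \<open>Q\<close> is the eigenspace of -1.\<close>
  have norm_Q: "norm (Q x) = norm ((1/2) *\<^sub>R (x + S x))" for x
  proof -
    have "(norm (Q x))\<^sup>2 = inner x (Q (Q x))" by (simp add: power2_norm_eq_inner Q_adj)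
    also have "\<dots> = (norm ((1/2) *\<^sub>R (x + S x)))\<^sup>2"
      using unitary_inner[OF S, of x x] S_adj(1)[of x x]
      unfolding power2_norm_eq_inner QQ B_def
      by (simp add: inner_add_left inner_add_right inner_diff_right inner_commute[of "S x" x] field_simps)
    finally show ?thesis by simp
  qed
  have Q_eigen: "Q v = 0" if v: "S v = - v" for v
    using norm_Q[of v] v by simp
  have eigen_orth: "inner (x + S x) v = 0" if v: "S v = - v" for x v
    using unitary_inner[OF S, of x v] v by (simp add: inner_add_left)
  have eigen_J: "S (J v) = - J v" if "S v = - v" for v
    using that by (simp add: unitary_J[OF S] lins)
  have eigenI: "S v = - v" if "v + S v = 0" for v using that by (simp add: eq_neg_iff_add_eq_0 add.commute)
  define G where "G = {(Q x + v, (1/2) *\<^sub>R (x + S x) + J v) | x v. S v = - v}"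
  have "\<exists>R. unitary R \<and> (\<forall>a b. (a, b) \<in> G \<longrightarrow> R a = b)"
  proof (rule unitary_from_dense_graph)
    show "subspace G"
    proof (rule subspaceI)
      show "0 \<in> G"
        unfolding G_def zero_prod_def
        by (rule CollectI, rule exI[of _ 0], rule exI[of _ 0])
          (simp add: linear_0[OF linQ] linear_0[OF lin(1)] linear_0[OF lin(3)])
    next
      fix p q assume "p \<in> G" "q \<in> G"
      then obtain x v y w where eq: "S v = - v" "S w = - w"
        "p = (Q x + v, (1/2) *\<^sub>R (x + S x) + J v)" "q = (Q y + w, (1/2) *\<^sub>R (y + S y) + J w)"
        unfolding G_def by blast
      show "p + q \<in> G"
        unfolding G_def using eq
        by (intro CollectI exI[of _ "x + y"] exI[of _ "v + w"])
          (simp add: lins linear_add[OF linQ] scaleR_add_right)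
    next
      fix c :: real and p assume "p \<in> G"
      then obtain x v where eq: "S v = - v" "p = (Q x + v, (1/2) *\<^sub>R (x + S x) + J v)"
        unfolding G_def by blast
      show "c *\<^sub>R p \<in> G"
        unfolding G_def using eq
        by (intro CollectI exI[of _ "c *\<^sub>R x"] exI[of _ "c *\<^sub>R v"])
          (simp add: lins linear_scale[OF linQ] scaleR_add_right)
    qed
    show "norm a = norm b" if ab: "(a, b) \<in> G" for a b
    proof -
      obtain x v where v: "S v = - v" and a: "a = Q x + v" and b: "b = (1/2) *\<^sub>R (x + S x) + J v"
        using ab unfolding G_def by blast
      have "inner (Q x) v = 0" by (simp add: Q_adj Q_eigen v)
      moreover have "inner ((1/2) *\<^sub>R (x + S x)) (J v) = 0"
        using eigen_orth[OF eigen_J[OF v]] by simp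
      ultimately have "(norm a)\<^sup>2 = (norm (Q x))\<^sup>2 + (norm v)\<^sup>2"
        "(norm b)\<^sup>2 = (norm ((1/2) *\<^sub>R (x + S x)))\<^sup>2 + (norm (J v))\<^sup>2"
        unfolding a b by (simp_all only: norm_add_Pythagorean orthogonal_def)
      then have "(norm a)\<^sup>2 = (norm b)\<^sup>2" by (simp only: norm_Q norm_J)
      then show ?thesis by simp
    qed
    show "(J a, J b) \<in> G" if ab: "(a, b) \<in> G" for a b
    proof -
      obtain x v where v: "S v = - v" and a: "a = Q x + v" and b: "b = (1/2) *\<^sub>R (x + S x) + J v"
        using ab unfolding G_def by blast
      show ?thesis
        unfolding G_def using v
        by (intro CollectI exI[of _ "J x"] exI[of _ "J v"])
          (simp add: a b lins QJ eigen_J unitary_J[OF S])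
    qed
    show "y = 0" if y: "\<And>a b. (a, b) \<in> G \<Longrightarrow> inner a y = 0" for y
    proof -
      have y: "inner (Q x + v) y = 0" if "S v = - v" for x v
        using y that unfolding G_def by blast
      \<comment> \<open>Orthogonality to the range of the selfadjoint \<open>Q\<close> puts
        \<open>y\<close> into its kernel, that is into the eigenspace of -1, to which
        \<open>y\<close> is orthogonal as well.\<close>
      have "Q y = 0"
        using y[of 0 "Q y"] by (simp add: Q_adj linear_0[OF lin(1)]) (metis Q_adj inner_eq_zero_iff)
      then have "S y = - y" using norm_Q[of y] by (intro eigenI) simp
      then show ?thesis using y[of y 0] by (simp add: linear_0[OF linQ])
    qed
    show "y = 0" if y: "\<And>a b. (a, b) \<in> G \<Longrightarrow> inner b y = 0" for y
    proof -
      have y: "inner ((1/2) *\<^sub>R (x + S x) + J v) y = 0" if "S v = - v" for x v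
        using y that unfolding G_def by blast
      \<comment> \<open>Orthogonality to the range of 1 + S says that the adjoint 1 + inv S kills
        \<open>y\<close>, so \<open>y\<close> lies in the eigenspace of -1. As \<open>J\<close> maps
        this eigenspace onto itself, \<open>y\<close> is the image of \<open>- J y\<close>.\<close>
      have "inner x (y + inv S y) = 0" for x
        using y[of 0 x] by (simp add: linear_0[OF lin(1)] linear_0[OF lin(3)] inner_add_left inner_add_right S_adj)
      then have "y + inv S y = 0" using inner_eq_zero_iff by blast
      then have "S y + y = 0" using lins(1)[of y "inv S y"] S linear_0[OF lin(1)] by simp
      then have "S y = - y" by (intro eigenI) (simp add: add.commute)
      then show ?thesis
        using y[of "- J y" 0] eigen_J[of y]
        by (simp add: linear_0[OF lin(1)] lins J_J)
    qed
  qed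
  then obtain R where R: "unitary R" and R_G: "\<And>a b. (a, b) \<in> G \<Longrightarrow> R a = b" by blast
  have R_eq: "R (Q x + v) = (1/2) *\<^sub>R (x + S x) + J v" if "S v = - v" for x v
    by (rule R_G) (use that in \<open>auto simp: G_def\<close>)
  have R_Q: "R (Q x) = (1/2) *\<^sub>R (x + S x)" for x
    using R_eq[of 0 x] by (simp add: linear_0[OF lin(1)] linear_0[OF lin(3)])
  have R_v: "R v = J v" if "S v = - v" for v
    using R_eq[OF that, of 0] by (simp add: linear_0[OF lin(1)] linear_0[OF linQ])
  \<comment> \<open>The range of \<open>Q\<close> and the eigenspace of -1 together span a dense
    subspace, and on each of them \<open>R\<close> is expressed through \<open>S\<close> and
    \<open>J\<close>, with which \<open>C\<close> commutes.\<close>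
  have comm: "C (R x) = R (C x)"
    if C: "bounded_linear C" "\<forall>x. C (J x) = J (C x)" "\<forall>x. C (S x) = S (C x)" for C x
  proof (rule bounded_linear_eqI[of "\<lambda>x. C (R x)" "\<lambda>x. R (C x)"])
    note linC = bounded_linear.linear[OF C(1)]
    show "bounded_linear (\<lambda>x. C (R x))" "bounded_linear (\<lambda>x. R (C x))"
      using bounded_linear_compose C(1) unitary_bounded_linear[OF R] by blast+
    have QC: "C (Q x) = Q (C x)" for x using Q_comm[OF C(1)] comm_B[OF C(1,3)] by blast
    show "y = 0" if y: "\<And>x. C (R x) = R (C x) \<Longrightarrow> inner x y = 0" for y
    proof -
      have *: "inner (Q x) y = 0" for x
        by (rule y) (simp add: R_Q QC linear_add[OF linC] linear_scale[OF linC] C)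
      have **: "inner v y = 0" if "S v = - v" for v
      proof (rule y)
        have "S (C v) = - C v" using C(3) that by (metis linC linear_neg)
        then show "C (R v) = R (C v)" using that by (simp add: R_v C(2))
      qed
      have "Q y = 0" using *[of "Q y"] by (simp add: Q_adj) (metis Q_adj inner_eq_zero_iff)
      then have "S y = - y" using norm_Q[of y] by (intro eigenI) simp
      from **[OF this] show ?thesis by simp
    qed
  qed
  have "R (R x) = S x" for x
  proof (rule bounded_linear_eqI[of "\<lambda>x. R (R x)" S])
    show "bounded_linear (\<lambda>x. R (R x))" "bounded_linear S"
      using bounded_linear_compose unitary_bounded_linear[OF R] blS by blast+
    show "y = 0" if y: "\<And>x. R (R x) = S x \<Longrightarrow> inner x y = 0" for y
    proof -
      \<comment> \<open>The second \<open>Q\<close> keeps the argument in reach of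
        \<open>R_Q\<close>: one application of \<open>R\<close> yields a vector that is again of the
        form \<open>Q z\<close>, with z half of \<open>x + S x\<close>.\<close>
      have *: "inner (Q (Q x)) y = 0" for x
      proof (rule y)
        have "R (R (Q (Q x))) = R (Q ((1/2) *\<^sub>R (x + S x)))"
          by (simp add: R_Q linear_add[OF linQ] linear_scale[OF linQ] QS)
        also have "\<dots> = S (Q (Q x))"
        proof -
          have "(1/2) *\<^sub>R ((1/2) *\<^sub>R (u + v) + (1/2) *\<^sub>R (v + w)) = v - (1/4) *\<^sub>R (2 *\<^sub>R v - w - u)"
            for u v w :: 'a
          proof -
            have "inner z ((1/2) *\<^sub>R ((1/2) *\<^sub>R (u + v) + (1/2) *\<^sub>R (v + w)))
                = inner z (v - (1/4) *\<^sub>R (2 *\<^sub>R v - w - u))" for z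
              by (simp add: inner_add_right inner_diff_right field_simps)
            then show ?thesis by (metis vector_eq_ldot)
          qed
          from this[of x "S x" "S (S x)"] show ?thesis
            unfolding R_Q QQ B_def by (simp add: lins S)
        qed
        finally show "R (R (Q (Q x))) = S (Q (Q x))" .
      qed
      have **: "inner v y = 0" if "S v = - v" for v
        by (rule y) (simp add: R_v that eigen_J J_J)
      have "Q (Q y) = 0" using *[of y] *[of "Q (Q y)"] by (simp add: Q_adj) (metis Q_adj inner_eq_zero_iff)
      then have "Q y = 0" by (metis Q_adj inner_eq_zero_iff inner_zero_right)
      then have "S y = - y" using norm_Q[of y] by (intro eigenI) simp
      from **[OF this] show ?thesis by simp
    qed
  qed
  with R comm show ?thesis by blast
qed

end

section \<open>Extending a unitary solution of \<open>U T inv U = T\<^sup>2\<close>\<close>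

context complex_structure
begin

section \<open>Orthogonal projections commuting with the complex structure\<close>

definition projection :: "('a \<Rightarrow> 'a) \<Rightarrow> bool" where
  "projection P \<longleftrightarrow> linear P \<and> (\<forall>x. P (P x) = P x)
    \<and> (\<forall>x y. inner (P x) y = inner x (P y)) \<and> (\<forall>x. P (J x) = J (P x))"

lemma projection_linear: "projection P \<Longrightarrow> linear P"
  and projection_idem: "projection P \<Longrightarrow> P (P x) = P x"
  and projection_adj: "projection P \<Longrightarrow> inner (P x) y = inner x (P y)"
  and projection_J: "projection P \<Longrightarrow> P (J x) = J (P x)"
  by (simp_all add: projection_def)

lemma projection_bounded_linear:
  assumes P: "projection P"
  shows "bounded_linear P"
proof (rule bounded_linear_intro[of _ 1])
  show "norm (P x) \<le> norm x * 1" for x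
  proof -
    have "(norm (P x))\<^sup>2 = inner (P x) x"
      by (simp add: power2_norm_eq_inner projection_adj[OF P] projection_idem[OF P] inner_commute)
    also have "\<dots> \<le> norm (P x) * norm x" by (rule norm_cauchy_schwarz)
    finally show ?thesis
      by (metis mult.right_neutral mult_le_cancel_left norm_ge_zero norm_le_zero_iff not_less
          order_trans power2_eq_square)
  qed
qed (simp_all add: projection_linear[OF P] linear_add linear_scale)

text \<open>\<open>P\<close> projects along \<open>W\<close> onto its orthogonal complement. The
  complement is the input because in the application it is described by orthogonality conditions,
  which make it closed at once.\<close>

lemma exists_projection:
  assumes W: "subspace W" "closed W" and WJ: "\<And>w. w \<in> W \<Longrightarrow> J w \<in> W"
  shows "\<exists>P. projection P \<and> (\<forall>x. x - P x \<in> W) \<and> (\<forall>w\<in>W. P w = 0)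
    \<and> (\<forall>x. (\<forall>w\<in>W. inner x w = 0) \<longrightarrow> P x = x) \<and> (\<forall>x. \<forall>w\<in>W. inner (P x) w = 0)"
proof -
  have "\<forall>x. \<exists>w. w \<in> W \<and> (\<forall>v\<in>W. inner (x - w) v = 0)"
    using exists_orthogonal_decomposition[OF W] by blast
  then obtain E where E: "\<And>x. E x \<in> W" "\<And>x v. v \<in> W \<Longrightarrow> inner (x - E x) v = 0" by metis
  define P where "P x = x - E x" for x
  have PW: "x - P x \<in> W" and P_orth: "w \<in> W \<Longrightarrow> inner (P x) w = 0" for x w
    by (simp_all add: P_def E)
  \<comment> \<open>The two conditions characterize \<open>P x\<close>; each property of
    \<open>P\<close> below is obtained by verifying them for the claimed value.\<close>
  have P_eq: "P x = y" if "x - y \<in> W" "\<And>w. w \<in> W \<Longrightarrow> inner y w = 0" for x y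
  proof -
    have "(x - y) - (x - P x) \<in> W" by (rule subspace_diff[OF W(1) that(1) PW])
    then have "P x - y \<in> W" by simp
    from P_orth[OF this, of x] that(2)[OF this] have "inner (P x - y) (P x - y) = 0"
      by (simp only: inner_diff_left)
    then show ?thesis by simp
  qed
  have adj: "inner (P x) y = inner x (P y)" for x y
  proof -
    have "inner (P x) (y - P y) = 0" "inner (P y) (x - P x) = 0" using P_orth PW by blast+
    then show ?thesis by (simp add: inner_diff_right inner_commute)
  qed
  have "projection P"
    unfolding projection_def
  proof (intro conjI allI adj)
    show "linear P"
    proof (rule linearI)
      show "P (x + y) = P x + P y" for x y
        using subspace_add[OF W(1) PW[of x] PW[of y]]
        by (intro P_eq) (simp_all add: algebra_simps inner_add_left P_orth)
      show "P (r *\<^sub>R x) = r *\<^sub>R P x" for r x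
        using subspace_scale[OF W(1) PW[of x], of r]
        by (intro P_eq) (simp_all add: scaleR_diff_right P_orth)
    qed
    show "P (P x) = P x" for x by (rule P_eq) (simp_all add: P_orth subspace_0[OF W(1)])
    show "P (J x) = J (P x)" for x
    proof (rule P_eq)
      show "J x - J (P x) \<in> W" using WJ[OF PW[of x]] by (simp add: linear_diff[OF linear_J])
      show "inner (J (P x)) w = 0" if "w \<in> W" for w
      proof -
        have "inner (J (P x)) (J (J w)) = inner (P x) (J w)"
          by (rule isometry_inner[OF linear_J norm_J])
        then show ?thesis using P_orth[OF WJ[OF that]] by (simp add: J_J)
      qed
    qed
  qed
  moreover have "P w = 0" if "w \<in> W" for w by (rule P_eq) (use that in simp_all)
  moreover have "P x = x" if "\<forall>w\<in>W. inner x w = 0" for x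
    by (rule P_eq) (use that subspace_0[OF W(1)] in simp_all)
  ultimately show ?thesis using PW P_orth by blast
qed

lemma projection_conjugate:
  assumes U: "unitary U" and P: "projection P"
  shows "projection (\<lambda>x. U (P (inv U x)))"
  unfolding projection_def
proof (intro conjI allI)
  note lin = unitary_linear[OF U] unitary_linear[OF unitary_inv[OF U]] projection_linear[OF P]
  show "linear (\<lambda>x. U (P (inv U x)))"
    by (rule linearI) (simp_all add: lin linear_add linear_scale)
  show "inner (U (P (inv U x))) y = inner x (U (P (inv U y)))" for x y
    by (metis P U inner_commute projection_adj unitary_inner_inv)
qed (simp_all add: U projection_idem[OF P] projection_J[OF P] unitary_J[OF U]
    unitary_J[OF unitary_inv[OF U]])

text \<open>The hypothesis places the range of \<open>P\<close> inside that of \<open>P'\<close>;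
  taking adjoints reverses the order of the factors.\<close>

lemma projection_comm_swap:
  assumes "projection P" "projection P'" and "\<And>x. P' (P x) = P x"
  shows "P (P' x) = P x"
proof -
  have "inner (P (P' x)) y = inner (P x) y" for y
    by (simp add: projection_adj[OF assms(1)] projection_adj[OF assms(2)] assms(3))
  then show ?thesis by (metis vector_eq_rdot)
qed

text \<open>Invariance of the range under \<open>inv S\<close>, the adjoint of \<open>S\<close>,
  amounts to invariance of its complement under \<open>S\<close>. In infinite dimension this does
  not follow from invariance under \<open>S\<close> alone.\<close>

lemma unitary_projection_comm:
  assumes S: "unitary S" and P: "projection P"
    and inv: "\<And>x. P (S (P x)) = S (P x)" "\<And>x. P (inv S (P x)) = inv S (P x)"
  shows "S (P x) = P (S x)"
proof -
  have "inner (P (S x)) y = inner (P (S (P x))) y" for y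
    by (simp add: projection_adj[OF P] unitary_inner_inv[OF S] inv(2))
  then have "P (S x) = P (S (P x))" by (metis vector_eq_rdot)
  then show ?thesis by (simp add: inv(1))
qed

text \<open>With \<open>S = U A inv U\<close>, the operator \<open>A'\<close> is \<open>A\<close> on the range of \<open>P\<close> and a square root
  of \<open>S\<close> on its complement. It commutes with \<open>P'\<close> because that square root commutes with
  everything that commutes with \<open>S\<close>.\<close>
lemma extension_step:
  assumes U: "unitary U" and A: "unitary A" and P: "projection P"
    and AP: "\<And>x. A (P x) = P (A x)"
    and UA: "\<And>x. U (A (inv U (P x))) = A (A (P x))"
    and mono: "\<And>x. U (P (inv U (P x))) = P x"
  defines "P' \<equiv> \<lambda>x. U (P (inv U x))"
  shows "\<exists>A'. unitary A' \<and> (\<forall>x. A' (A' x) = U (A (inv U x))) \<and> (\<forall>x. A' (P x) = A (P x))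
    \<and> (\<forall>x. A' (P' x) = P' (A' x))"
proof -
  define S where "S x = U (A (inv U x))" for x
  have S: "unitary S"
    unfolding S_def[abs_def] by (rule unitary_compose[OF U unitary_compose[OF A unitary_inv[OF U]]])
  have P': "projection P'" unfolding P'_def by (rule projection_conjugate[OF U P])
  note linP = projection_linear[OF P]
  \<comment> \<open>By \<open>UA\<close>, \<open>S\<close> is the square of \<open>A\<close> on the
    range of \<open>P\<close>, and \<open>A\<close> and its inverse preserve this range.\<close>
  have SP: "S (P x) = P (S x)" for x
  proof (rule unitary_projection_comm[OF S P])
    show "P (S (P x)) = S (P x)" for x
      by (simp add: S_def UA AP projection_idem[OF P])
    have A'P: "P (inv A x) = inv A (P x)" for x by (metis A AP unitary_inv_left unitary_inv_right)
    have "S (P (inv A (inv A x))) = P x" for x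
      unfolding S_def UA by (simp add: A'P A)
    then have "inv S (P x) = P (inv A (inv A x))" for x by (metis S unitary_inv_left)
    then show "P (inv S (P x)) = inv S (P x)" for x by (simp add: projection_idem[OF P])
  qed
  obtain R where R: "unitary R" and RR: "\<And>x. R (R x) = S x"
    and R_comm: "\<And>C x. bounded_linear C \<Longrightarrow> (\<forall>x. C (J x) = J (C x)) \<Longrightarrow> (\<forall>x. C (S x) = S (C x))
      \<Longrightarrow> C (R x) = R (C x)"
    using unitary_sqrt[OF S] by blast
  have RP: "P (R x) = R (P x)" for x
    by (rule R_comm) (simp_all add: projection_bounded_linear[OF P] projection_J[OF P] SP)
  have SP': "P' (S x) = S (P' x)" for x by (simp add: P'_def S_def U AP)
  have RP': "P' (R x) = R (P' x)" for x
    by (rule R_comm) (simp_all add: projection_bounded_linear[OF P'] projection_J[OF P'] SP')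
  define A' where "A' x = A (P x) + R (x - P x)" for x
  note lins = linear_add[OF linP] linear_diff[OF linP] linear_scale[OF linP]
    unitary_linear[OF A, THEN linear_add] unitary_linear[OF A, THEN linear_scale]
    unitary_linear[OF A, THEN linear_diff]
    unitary_linear[OF R, THEN linear_add] unitary_linear[OF R, THEN linear_scale]
    unitary_linear[OF R, THEN linear_diff] linear_diff[OF linear_J]
    linear_add[OF linear_J] projection_linear[OF P', THEN linear_add]
    projection_linear[OF P', THEN linear_diff]
  have A'_P: "A' (P x) = A (P x)" for x
    using linear_0[OF unitary_linear[OF R]] by (simp add: A'_def projection_idem[OF P])
  have A'_Q: "A' (x - P x) = R (x - P x)" for x
    using linear_0[OF unitary_linear[OF A]] by (simp add: A'_def projection_idem[OF P] lins)
  have add: "A' (x + y) = A' x + A' y" for x y by (simp add: A'_def lins)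
  have A'_A': "A' (A' x) = S x" for x
  proof -
    have "A' (A' x) = A' (A (P x)) + A' (R (x - P x))" by (simp add: A'_def[of x] add)
    also have "A' (A (P x)) = S (P x)" by (simp add: AP A'_P S_def UA)
    also have "A' (R (x - P x)) = S (x - P x)"
      using A'_Q[of "R x"] by (simp add: lins RP flip: RR)
    finally show ?thesis
      by (metis S add_diff_cancel_left' diff_add_cancel linear_add unitary_linear add.commute)
  qed
  have "unitary A'"
    unfolding unitary_def
  proof (intro conjI allI)
    show "linear A'"
      by (rule linearI) (simp_all add: A'_def lins algebra_simps)
    show "norm (A' x) = norm x" for x
    proof -
      have orth: "inner (P u) (v - P v) = 0" for u v
        by (simp add: projection_adj[OF P] projection_idem[OF P] lins)
      have "(norm (A' x))\<^sup>2 = (norm (A (P x)))\<^sup>2 + (norm (R (x - P x)))\<^sup>2"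
        using orth[of "A x" "R x"] unfolding A'_def
        by (intro norm_add_Pythagorean) (simp add: orthogonal_def AP lins RP)
      also have "\<dots> = (norm (P x + (x - P x)))\<^sup>2"
        by (subst norm_add_Pythagorean)
          (simp_all add: orthogonal_def orth unitary_norm[OF A] unitary_norm[OF R])
      finally show ?thesis by simp
    qed
    show "surj A'" by (rule surjI[of _ "\<lambda>x. A' (inv S x)"]) (simp add: A'_A' S)
    show "A' (J x) = J (A' x)" for x
      by (simp add: A'_def lins projection_J[OF P] unitary_J[OF A] unitary_J[OF R]
          flip: linear_diff[OF linear_J])
  qed
  moreover have "A' (P' x) = P' (A' x)" for x
  proof -
    \<comment> \<open>The range of \<open>P\<close> lies in that of \<open>P'\<close>. Hence A P
      commutes with \<open>P'\<close>, as do \<open>R\<close> and 1 - P, and \<open>A'\<close> is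
      assembled from these.\<close>
    have P'P: "P' (P y) = P y" for y by (simp add: P'_def mono)
    have "P (P' x) = P x" by (rule projection_comm_swap[OF P P' P'P])
    moreover have "P' (A (P x)) = A (P x)" by (simp add: AP P'P)
    ultimately show ?thesis
      by (simp add: A'_def lins RP' P'P)
  qed
  ultimately show ?thesis using A'_A' A'_P by (auto simp: S_def)
qed

text \<open>On \<open>V\<^sub>n\<close>, the range of \<open>U\<^sup>n P U\<^sup>-\<^sup>n\<close>, the operators produced by iterating
  \<open>extension_step\<close> are constant from the \<open>n\<close>-th on, and \<open>total\<close> says that the
  increasing union of the \<open>V\<^sub>n\<close> is dense.\<close>
lemma unitary_extension:
  assumes U: "unitary U" and A: "unitary A" and P: "projection P"
    and AP: "\<And>x. A (P x) = P (A x)"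
    and UA: "\<And>x. U (A (inv U (P x))) = A (A (P x))"
    and mono: "\<And>x. U (P (inv U (P x))) = P x"
    and total: "\<And>y. (\<And>n. P ((inv U ^^ n) y) = 0) \<Longrightarrow> y = 0"
  shows "\<exists>A'. unitary A' \<and> (\<forall>x. U (A' (inv U x)) = A' (A' x)) \<and> (\<forall>x. A' (P x) = A (P x))"
proof -
  define Pn where "Pn = rec_nat P (\<lambda>_ Q x. U (Q (inv U x)))"
  have Pn_simps: "Pn 0 x = P x" "Pn (Suc n) x = U (Pn n (inv U x))" for n x
    by (simp_all add: Pn_def)
  have proj: "projection (Pn n)" for n
  proof (induction n)
    case (Suc n)
    then show ?case using projection_conjugate[OF U Suc] by (simp add: Pn_simps(2)[abs_def])
  qed (simp add: Pn_simps(1)[abs_def] P)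
  have mono1: "Pn (Suc n) (Pn n x) = Pn n x" for n x
    by (induction n arbitrary: x) (simp_all add: Pn_simps mono U)
  have mono_le: "Pn m (Pn n x) = Pn n x" if "n \<le> m" for n m x
    using that
  proof (induction m rule: dec_induct)
    case (step m)
    then show ?case by (metis mono1)
  qed (simp add: projection_idem[OF proj])
  have total': "y = 0" if y: "\<And>n x. inner (Pn n x) y = 0" for y
  proof (rule total)
    fix n
    have "Pn n y = 0"
      using y[of n y] by (metis inner_eq_zero_iff projection_adj[OF proj] projection_idem[OF proj])
    then show "P ((inv U ^^ n) y) = 0"
    proof (induction n arbitrary: y)
      case (Suc n)
      then have "Pn n (inv U y) = 0"
        by (metis Pn_simps(2) U norm_eq_zero unitary_norm)
      from Suc.IH[OF this] show ?case by (simp add: funpow_swap1)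
    qed (simp add: Pn_simps)
  qed
  \<comment> \<open>What \<open>extension_step\<close> needs at level \<open>n\<close>, together
    with agreement with the original operator on the range of \<open>P\<close>.\<close>
  define I where "I n B \<longleftrightarrow> unitary B \<and> (\<forall>x. B (Pn n x) = Pn n (B x))
    \<and> (\<forall>x. U (B (inv U (Pn n x))) = B (B (Pn n x))) \<and> (\<forall>x. B (P x) = A (P x))" for n B
  have "\<exists>f. \<forall>n. I n (f n) \<and> ((\<forall>x. f (Suc n) (f (Suc n) x) = U (f n (inv U x)))
      \<and> (\<forall>x. f (Suc n) (Pn n x) = f n (Pn n x)))"
  proof (rule dependent_nat_choice)
    show "\<exists>B. I 0 B"
      using A AP UA by (intro exI[of _ A]) (simp add: I_def Pn_simps)
  next
    fix B n assume B: "I n B"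
    obtain B' where B': "unitary B'" "\<And>x. B' (B' x) = U (B (inv U x))" "\<And>x. B' (Pn n x) = B (Pn n x)"
      "\<And>x. B' (Pn (Suc n) x) = Pn (Suc n) (B' x)"
      using extension_step[OF U _ proj[of n], of B] B mono1[of n] unfolding I_def Pn_simps by metis
    \<comment> \<open>\<open>extension_step\<close> expresses the square of \<open>B'\<close>
      through the old \<open>B\<close>. On the range of \<open>Pn (Suc n)\<close> the two may be
      exchanged, because \<open>inv U\<close> leads into the range of \<open>Pn n\<close>, where
      they agree.\<close>
    have "U (B' (inv U (Pn (Suc n) x))) = B' (B' (Pn (Suc n) x))" for x
      by (simp add: B'(2)) (simp add: Pn_simps U B'(3))
    moreover have "B' (P x) = A (P x)" for x
      using B'(3)[of "P x"] mono_le[of 0 n x] B by (simp add: Pn_simps I_def)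
    ultimately have "I (Suc n) B'" using B' by (simp add: I_def)
    with B' show "\<exists>B'. I (Suc n) B' \<and> (\<forall>x. B' (B' x) = U (B (inv U x))) \<and> (\<forall>x. B' (Pn n x) = B (Pn n x))"
      by blast
  qed
  then obtain f where fI: "\<And>n. I n (f n)" and ff: "\<And>n x. f (Suc n) (f (Suc n) x) = U (f n (inv U x))"
    and f_Suc: "\<And>n x. f (Suc n) (Pn n x) = f n (Pn n x)" by blast
  have fU: "unitary (f n)" and f_Pn: "f n (Pn n x) = Pn n (f n x)" and f_P: "f n (P x) = A (P x)" for n x
    using fI[of n] by (simp_all add: I_def)
  have f_le: "f m (Pn n x) = f n (Pn n x)" if "n \<le> m" for n m x
    using that
  proof (induction m rule: dec_induct)
    case (step m)
    then show ?case by (metis f_Suc mono_le)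
  qed simp
  \<comment> \<open>By \<open>f_le\<close> the operators agree on smaller levels, so two elements
    can be added at the larger of their levels.\<close>
  define G where "G = {(z, f n z) | n z. Pn n z = z}"
  have "\<exists>A'. unitary A' \<and> (\<forall>a b. (a, b) \<in> G \<longrightarrow> A' a = b)"
  proof (rule unitary_from_dense_graph)
    show "subspace G"
    proof (rule subspaceI)
      show "0 \<in> G"
        unfolding G_def zero_prod_def
        by (intro CollectI exI[of _ 0])
          (simp add: linear_0[OF unitary_linear[OF fU]] linear_0[OF projection_linear[OF proj]])
    next
      fix p q assume "p \<in> G" "q \<in> G"
      then obtain m n z w where p: "p = (z, f m z)" "Pn m z = z" and q: "q = (w, f n w)" "Pn n w = w"
        unfolding G_def by blast
      have "Pn (max m n) z = z" "Pn (max m n) w = w"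
        using mono_le[of m "max m n" z] mono_le[of n "max m n" w] p q by simp_all
      moreover have "f (max m n) z = f m z" "f (max m n) w = f n w"
        using f_le[of m "max m n" z] f_le[of n "max m n" w] p q by simp_all
      ultimately show "p + q \<in> G"
        unfolding G_def p q
        by (intro CollectI exI[of _ "max m n"] exI[of _ "z + w"])
          (simp add: linear_add[OF unitary_linear[OF fU]] linear_add[OF projection_linear[OF proj]])
    next
      fix c :: real and p assume "p \<in> G"
      then obtain n z where p: "p = (z, f n z)" "Pn n z = z"
        unfolding G_def by blast
      then show "c *\<^sub>R p \<in> G"
        unfolding G_def
        by (intro CollectI exI[of _ n] exI[of _ "c *\<^sub>R z"])
          (simp add: linear_scale[OF unitary_linear[OF fU]] linear_scale[OF projection_linear[OF proj]])
    qed
    show "norm a = norm b" if "(a, b) \<in> G" for a b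
      using that unitary_norm[OF fU] by (auto simp: G_def)
    show "(J a, J b) \<in> G" if "(a, b) \<in> G" for a b
    proof -
      obtain n where n: "b = f n a" "Pn n a = a" using \<open>(a, b) \<in> G\<close> unfolding G_def by blast
      show ?thesis
        unfolding G_def using n
        by (intro CollectI exI[of _ n] exI[of _ "J a"])
          (simp add: unitary_J[OF fU] projection_J[OF proj])
    qed
    have inG: "(Pn n x, f n (Pn n x)) \<in> G" for n x
      unfolding G_def using projection_idem[OF proj] by blast
    show "y = 0" if "\<And>a b. (a, b) \<in> G \<Longrightarrow> inner a y = 0" for y
      using total' that[OF inG] by blast
    show "y = 0" if y: "\<And>a b. (a, b) \<in> G \<Longrightarrow> inner b y = 0" for y
    proof (rule total')
      \<comment> \<open>Since \<open>f n\<close> commutes with \<open>Pn n\<close>, it maps the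
        range of \<open>Pn n\<close> onto itself: \<open>Pn n x\<close> is the image of
        \<open>Pn n (inv (f n) x)\<close>.\<close>
      show "inner (Pn n x) y = 0" for n x
        using y[OF inG[of n "inv (f n) x"]] by (simp add: f_Pn fU)
    qed
  qed
  then obtain A' where A': "unitary A'" and A'_G: "\<And>a b. (a, b) \<in> G \<Longrightarrow> A' a = b" by blast
  have A'_Pn: "A' (Pn n x) = f n (Pn n x)" for n x
    using projection_idem[OF proj] by (intro A'_G) (auto simp: G_def)
  have "A' (P x) = A (P x)" for x
    using A'_Pn[of 0 x] by (simp add: Pn_simps f_P)
  moreover have "U (A' (inv U x)) = A' (A' x)" for x
  proof (rule bounded_linear_eqI[of "\<lambda>x. U (A' (inv U x))" "\<lambda>x. A' (A' x)"])
    show "bounded_linear (\<lambda>x. U (A' (inv U x)))" "bounded_linear (\<lambda>x. A' (A' x))"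
      by (rule unitary_bounded_linear[OF unitary_compose[OF U unitary_compose[OF A' unitary_inv[OF U]]]],
        rule unitary_bounded_linear[OF unitary_compose[OF A' A']])
    show "y = 0" if y: "\<And>x. U (A' (inv U x)) = A' (A' x) \<Longrightarrow> inner x y = 0" for y
    proof (rule total')
      fix n x
      define z where "z = Pn n x"
      \<comment> \<open>Going one level up makes \<open>ff\<close> applicable: \<open>z\<close> and
        its image lie in the range of \<open>Pn (Suc n)\<close>, where \<open>A'\<close> is
        \<open>f (Suc n)\<close>, while \<open>inv U z\<close> lies in the range of
        \<open>Pn n\<close>, where \<open>A'\<close> is \<open>f n\<close>.\<close>
      have z: "Pn (Suc n) z = z" by (simp add: z_def mono1)
      have "A' (A' z) = f (Suc n) (f (Suc n) z)"
        using A'_Pn[of "Suc n"] f_Pn[of "Suc n"] z by metis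
      also have "\<dots> = U (f n (inv U z))" by (rule ff)
      also have "\<dots> = U (A' (inv U z))"
        using A'_Pn[of n "inv U z"] z by (metis Pn_simps(2) U unitary_inv_left)
      finally show "inner (Pn n x) y = 0" using y[of z] by (simp add: z_def)
    qed
  qed
  ultimately show ?thesis using A' by blast
qed

end

section \<open>The Hilbert space of square summable families\<close>

typedef 'i ell2 = "{f :: 'i \<Rightarrow> complex. (\<lambda>i. (cmod (f i))\<^sup>2) summable_on UNIV}"
  morphisms coord of_coords
  by (rule exI[of _ "\<lambda>_. 0"]) simp

lemma summable_coord: "(\<lambda>i. (cmod (coord x i))\<^sup>2) summable_on UNIV"
  using coord[of x] by simp

lemma coord_of_coords:
  "(\<lambda>i. (cmod (f i))\<^sup>2) summable_on UNIV \<Longrightarrow> coord (of_coords f) = f"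
  by (simp add: of_coords_inverse)

lemma ell2_eqI: "(\<And>i. coord x i = coord y i) \<Longrightarrow> x = y"
  by (metis coord_inject ext)

lemma square_summable_add:
  fixes f g :: "'i \<Rightarrow> complex"
  assumes "(\<lambda>i. (cmod (f i))\<^sup>2) summable_on UNIV" "(\<lambda>i. (cmod (g i))\<^sup>2) summable_on UNIV"
  shows "(\<lambda>i. (cmod (f i + g i))\<^sup>2) summable_on UNIV"
proof (rule summable_on_comparison_test)
  show "(\<lambda>i. 2 * ((cmod (f i))\<^sup>2 + (cmod (g i))\<^sup>2)) summable_on UNIV"
    by (intro summable_on_cmult_right summable_on_add assms)
  show "(cmod (f i + g i))\<^sup>2 \<le> 2 * ((cmod (f i))\<^sup>2 + (cmod (g i))\<^sup>2)" for i
  proof -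
    have "(cmod (f i + g i))\<^sup>2 \<le> (cmod (f i) + cmod (g i))\<^sup>2"
      by (intro power_mono norm_triangle_ineq) simp
    also have "\<dots> \<le> 2 * ((cmod (f i))\<^sup>2 + (cmod (g i))\<^sup>2)"
      using sum_squares_bound[of "cmod (f i)" "cmod (g i)"] by (simp add: power2_sum)
    finally show ?thesis .
  qed
qed simp

lemma square_summable_cmult:
  fixes f :: "'i \<Rightarrow> complex"
  assumes "(\<lambda>i. (cmod (f i))\<^sup>2) summable_on UNIV"
  shows "(\<lambda>i. (cmod (c * f i))\<^sup>2) summable_on UNIV"
  using summable_on_cmult_right[OF assms, of "(cmod c)\<^sup>2"]
  by (simp add: norm_mult power_mult_distrib)

instantiation ell2 :: (type) ab_group_add
begin

definition "0 = of_coords (\<lambda>_. 0)"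
definition "x + y = of_coords (\<lambda>i. coord x i + coord y i)"
definition "- x = of_coords (\<lambda>i. - coord x i)"
definition "x - y = of_coords (\<lambda>i. coord x i - coord y i)"

lemma coord_zero [simp]: "coord 0 i = 0"
  by (simp add: zero_ell2_def coord_of_coords)

lemma coord_add [simp]: "coord (x + y) i = coord x i + coord y i"
  unfolding plus_ell2_def
  by (subst coord_of_coords) (simp_all add: square_summable_add summable_coord)

lemma coord_uminus [simp]: "coord (- x) i = - coord x i"
  unfolding uminus_ell2_def by (subst coord_of_coords) (simp_all add: summable_coord)

lemma coord_diff [simp]: "coord (x - y) i = coord x i - coord y i"
proof -
  have "(\<lambda>i. (cmod (coord x i + coord (- y) i))\<^sup>2) summable_on UNIV"
    by (intro square_summable_add summable_coord)
  then show ?thesis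
    unfolding minus_ell2_def by (subst coord_of_coords) simp_all
qed

instance by standard (auto intro: ell2_eqI)

end

instantiation ell2 :: (type) real_inner
begin

definition "r *\<^sub>R x = of_coords (\<lambda>i. complex_of_real r * coord x i)" for r :: real and x :: "'a ell2"
definition "inner x y = (\<Sum>\<^sub>\<infinity>i. inner (coord x i) (coord y i))" for x y :: "'a ell2"
definition "norm x = sqrt (inner x x)" for x :: "'a ell2"
definition "sgn x = inverse (norm x) *\<^sub>R x" for x :: "'a ell2"
definition "dist x y = norm (x - y)" for x y :: "'a ell2"
definition "(uniformity :: ('a ell2 \<times> 'a ell2) filter) = (INF e\<in>{0<..}. principal {(x, y). dist x y < e})"
definition "open U \<longleftrightarrow> (\<forall>x\<in>U. eventually (\<lambda>(x', y). x' = x \<longrightarrow> y \<in> U) uniformity)" for U :: "'a ell2 set"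

lemma coord_scaleR [simp]: "coord (r *\<^sub>R x) i = complex_of_real r * coord x i"
  unfolding scaleR_ell2_def
  by (subst coord_of_coords) (simp_all add: square_summable_cmult summable_coord)

lemma has_sum_inner_ell2: "((\<lambda>i. inner (coord x i) (coord y i)) has_sum inner x y) UNIV"
proof -
  have "(\<lambda>i. norm (inner (coord x i) (coord y i))) summable_on UNIV"
  proof (rule summable_on_comparison_test)
    show "(\<lambda>i. (cmod (coord x i))\<^sup>2 + (cmod (coord y i))\<^sup>2) summable_on UNIV"
      by (intro summable_on_add summable_coord)
    show "norm (inner (coord x i) (coord y i)) \<le> (cmod (coord x i))\<^sup>2 + (cmod (coord y i))\<^sup>2" for i
    proof -
      have "norm (inner (coord x i) (coord y i)) \<le> cmod (coord x i) * cmod (coord y i)"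
        by (metis Cauchy_Schwarz_ineq2 real_norm_def)
      also have "\<dots> \<le> (cmod (coord x i))\<^sup>2 + (cmod (coord y i))\<^sup>2"
        using sum_squares_bound[of "cmod (coord x i)" "cmod (coord y i)"]
          mult_nonneg_nonneg[OF norm_ge_zero norm_ge_zero, of "coord x i" "coord y i"] by linarith
      finally show ?thesis .
    qed
  qed simp
  then show ?thesis
    unfolding inner_ell2_def by (rule has_sum_infsum[OF Infinite_Sum.abs_summable_summable])
qed

instance
proof
  fix x y z :: "'a ell2" and r s :: real
  show "r *\<^sub>R (x + y) = r *\<^sub>R x + r *\<^sub>R y" "(r + s) *\<^sub>R x = r *\<^sub>R x + s *\<^sub>R x"
    "r *\<^sub>R s *\<^sub>R x = (r * s) *\<^sub>R x" "1 *\<^sub>R x = x"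
    by (auto intro!: ell2_eqI simp: algebra_simps)
  show "inner x y = inner y x" by (simp add: inner_ell2_def inner_commute)
  show "inner (x + y) z = inner x z + inner y z"
    using has_sum_add[OF has_sum_inner_ell2[of x z] has_sum_inner_ell2[of y z]]
    by (intro has_sum_unique[OF has_sum_inner_ell2]) (simp add: inner_add_left)
  show "inner (r *\<^sub>R x) y = r * inner x y"
    using has_sum_cmult_right[OF has_sum_inner_ell2[of x y], of r]
    by (intro has_sum_unique[OF has_sum_inner_ell2]) (simp add: scaleR_conv_of_real[symmetric])
  show "0 \<le> inner x x" unfolding inner_ell2_def by (intro infsum_nonneg) simp
  show "inner x x = 0 \<longleftrightarrow> x = 0"
  proof
    assume 0: "inner x x = 0"
    show "x = 0"
    proof (rule ell2_eqI)
      fix i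
      have "inner (coord x i) (coord x i) = 0"
        using has_sum_inner_ell2[of x x] 0
        by (intro nonneg_has_sum_le_0D[where A = UNIV]) auto
      then show "coord x i = coord 0 i" by simp
    qed
  qed (simp add: inner_ell2_def)
qed (simp_all add: norm_ell2_def sgn_ell2_def dist_ell2_def uniformity_ell2_def open_ell2_def)

end

lemma has_sum_norm_ell2: "((\<lambda>i. (cmod (coord x i))\<^sup>2) has_sum (norm x)\<^sup>2) UNIV"
  using has_sum_inner_ell2[of x x] by (simp add: power2_norm_eq_inner)

lemma sum_norm_ell2_le: "finite F \<Longrightarrow> (\<Sum>i\<in>F. (cmod (coord x i))\<^sup>2) \<le> (norm x)\<^sup>2"
  using has_sum_norm_ell2[of x] has_sum_mono2[OF has_sum_finite has_sum_norm_ell2]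
  by (meson has_sum_finite has_sum_mono2 subset_UNIV zero_le_power2)

lemma norm_coord_le: "cmod (coord x i) \<le> norm x"
  using sum_norm_ell2_le[of "{i}" x] by simp

instance ell2 :: (type) banach
proof
  fix X :: "nat \<Rightarrow> 'a ell2"
  assume X: "Cauchy X"
  have "Cauchy (\<lambda>n. coord (X n) i)" for i
  proof (rule CauchyI)
    fix e :: real assume "0 < e"
    then obtain M where "\<forall>m\<ge>M. \<forall>n\<ge>M. norm (X m - X n) < e" using CauchyD[OF X] by blast
    then show "\<exists>M. \<forall>m\<ge>M. \<forall>n\<ge>M. norm (coord (X m) i - coord (X n) i) < e"
      by (metis coord_diff le_less_trans norm_coord_le)
  qed
  then have "\<forall>i. \<exists>l. (\<lambda>n. coord (X n) i) \<longlonglongrightarrow> l"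
    by (simp add: Cauchy_convergent_iff convergent_def)
  then obtain g where g: "\<And>i. (\<lambda>n. coord (X n) i) \<longlonglongrightarrow> g i" by metis
  \<comment> \<open>On a finite set of coordinates the limit can be taken termwise. The bound does
    not depend on the set, so it yields both square summability of the limit and convergence in
    norm.\<close>
  have bound: "(\<Sum>i\<in>F. (cmod (coord (X m) i - g i))\<^sup>2) \<le> e\<^sup>2"
    if N: "\<forall>m\<ge>N. \<forall>n\<ge>N. norm (X m - X n) < e" and m: "m \<ge> N" and F: "finite F" for N m e F
  proof (rule tendsto_upperbound)
    show "(\<lambda>n. \<Sum>i\<in>F. (cmod (coord (X m) i - coord (X n) i))\<^sup>2)
        \<longlonglongrightarrow> (\<Sum>i\<in>F. (cmod (coord (X m) i - g i))\<^sup>2)"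
      by (intro tendsto_intros g)
    show "\<forall>\<^sub>F n in sequentially. (\<Sum>i\<in>F. (cmod (coord (X m) i - coord (X n) i))\<^sup>2) \<le> e\<^sup>2"
    proof (rule eventually_sequentiallyI)
      fix n assume "N \<le> n"
      then have "norm (X m - X n) \<le> e" using N m by (simp add: less_imp_le)
      then have "(norm (X m - X n))\<^sup>2 \<le> e\<^sup>2" by (intro power_mono) simp_all
      with sum_norm_ell2_le[OF F, of "X m - X n"]
      show "(\<Sum>i\<in>F. (cmod (coord (X m) i - coord (X n) i))\<^sup>2) \<le> e\<^sup>2" by simp
    qed
  qed simp
  have diff_summable: "(\<lambda>i. (cmod (coord (X m) i - g i))\<^sup>2) summable_on UNIV"
    if N: "\<forall>m\<ge>N. \<forall>n\<ge>N. norm (X m - X n) < e" and m: "m \<ge> N" for N m e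
    using bound[OF N m] by (intro nonneg_bdd_above_summable_on) (auto intro!: bdd_aboveI)
  obtain N where N: "\<forall>m\<ge>N. \<forall>n\<ge>N. norm (X m - X n) < 1" using CauchyD[OF X, of 1] by auto
  \<comment> \<open>\<open>g\<close> written as X N - (X N - g), a combination of two square
    summable families.\<close>
  have "(\<lambda>i. (cmod (coord (X N) i + (- 1) * (coord (X N) i - g i)))\<^sup>2) summable_on UNIV"
    by (intro square_summable_add square_summable_cmult summable_coord diff_summable[OF N]) simp
  then have g_coord: "coord (of_coords g) = g" by (intro coord_of_coords) simp
  have "X \<longlonglongrightarrow> of_coords g"
  proof (rule LIMSEQ_I)
    fix e :: real assume e: "0 < e"
    then obtain M where M: "\<forall>m\<ge>M. \<forall>n\<ge>M. norm (X m - X n) < e/2"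
      using CauchyD[OF X, of "e/2"] by auto
    have "norm (X m - of_coords g) < e" if "m \<ge> M" for m
    proof -
      have "(norm (X m - of_coords g))\<^sup>2 \<le> (e/2)\<^sup>2"
      proof (rule has_sum_le_finite_sums[OF has_sum_norm_ell2])
        show "(\<Sum>i\<in>F. (cmod (coord (X m - of_coords g) i))\<^sup>2) \<le> (e/2)\<^sup>2" if "finite F" for F
          using bound[OF M \<open>m \<ge> M\<close> that] by (simp add: g_coord)
      qed
      then have "norm (X m - of_coords g) \<le> e/2" using e by (simp add: power2_le_iff_abs_le)
      then show ?thesis using e by simp
    qed
    then show "\<exists>M. \<forall>m\<ge>M. norm (X m - of_coords g) < e" by blast
  qed
  then show "convergent X" by (auto simp: convergent_def)
qed

section \<open>Complex structure and coordinate permutations on \<open>ell2\<close>\<close>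

definition cmul :: "complex \<Rightarrow> 'i ell2 \<Rightarrow> 'i ell2" where
  "cmul c x = of_coords (\<lambda>i. c * coord x i)"

lemma coord_cmul [simp]: "coord (cmul c x) i = c * coord x i"
  unfolding cmul_def
  by (subst coord_of_coords) (simp_all add: square_summable_cmult summable_coord)

lemma norm_ell2_eqI:
  assumes "((\<lambda>i. (cmod (coord x i))\<^sup>2) has_sum r\<^sup>2) UNIV" "0 \<le> r"
  shows "norm x = r"
  using has_sum_unique[OF assms(1) has_sum_norm_ell2] assms(2) by simp

lemma complex_structure_ell2: "complex_structure (cmul \<i> :: 'a ell2 \<Rightarrow> 'a ell2)"
proof (rule complex_structure.intro)
  show "linear (cmul \<i> :: 'a ell2 \<Rightarrow> 'a ell2)"
    by (rule linearI) (auto intro!: ell2_eqI simp: algebra_simps)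
  show "cmul \<i> (cmul \<i> x) = - x" for x :: "'a ell2"
    by (rule ell2_eqI) simp
  show "norm (cmul \<i> x) = norm x" for x :: "'a ell2"
    using has_sum_norm_ell2[of x] by (intro norm_ell2_eqI) (simp_all add: norm_mult)
qed

interpretation ell2: complex_structure "cmul \<i>"
  by (rule complex_structure_ell2)

lemma cmul_eq: "cmul c x = Re c *\<^sub>R x + Im c *\<^sub>R cmul \<i> x"
proof (rule ell2_eqI)
  fix i
  have "c * coord x i = (of_real (Re c) + \<i> * of_real (Im c)) * coord x i"
    by (simp only: complex_eq[symmetric])
  then show "coord (cmul c x) i = coord (Re c *\<^sub>R x + Im c *\<^sub>R cmul \<i> x) i"
    by (simp add: algebra_simps)
qed

lemma inner_cmul_i: "inner (cmul \<i> x) (cmul \<i> y) = inner x y"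
  by (rule isometry_inner[OF ell2.linear_J ell2.norm_J])

lemma inner_cmul_i_left: "inner (cmul \<i> x) y = - inner x (cmul \<i> y)"
  using inner_cmul_i[of x "cmul \<i> y"] by (simp add: ell2.J_J inner_commute)

text \<open>The complex inner product recovered from its real part: being conjugate linear in the
  second argument, it satisfies Im <x, y> = Re <x, i y>.\<close>

definition cip :: "'i ell2 \<Rightarrow> 'i ell2 \<Rightarrow> complex" where
  "cip x y = Complex (inner x y) (inner x (cmul \<i> y))"

lemma cip_add_left: "cip (x + y) z = cip x z + cip y z"
  by (simp add: cip_def inner_add_left complex_eq_iff)

lemma cip_diff_left: "cip (x - y) z = cip x z - cip y z"
  by (simp add: cip_def inner_diff_left complex_eq_iff)

lemma cip_cnj: "cip y x = cnj (cip x y)"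
  by (simp add: cip_def inner_commute[of y] inner_cmul_i_left complex_eq_iff)

lemma cip_diff_right: "cip x (y - z) = cip x y - cip x z"
  by (metis cip_cnj cip_diff_left complex_cnj_diff)

lemma cip_cmul_left: "cip (cmul c x) y = c * cip x y"
  by (simp add: cip_def cmul_eq[of c] inner_add_left inner_cmul_i_left inner_cmul_i complex_eq_iff ell2.J_J)

lemma cip_self: "cip x x = complex_of_real ((norm x)\<^sup>2)"
proof -
  have "inner x (cmul \<i> x) = 0" using inner_cmul_i_left[of x x] by (simp add: inner_commute)
  then show ?thesis by (simp add: cip_def power2_norm_eq_inner complex_eq_iff)
qed

lemma unitary_cip: "ell2.unitary A \<Longrightarrow> cip (A x) (A y) = cip x y"
  by (simp add: cip_def ell2.unitary_inner flip: ell2.unitary_J)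

lemma unitary_cmul: "ell2.unitary A \<Longrightarrow> A (cmul c x) = cmul c (A x)"
  by (simp add: cmul_eq[of c] ell2.unitary_J ell2.unitary_linear linear_add linear_scale)

section \<open>Standard basis vectors and coordinate permutations\<close>

definition unit :: "'i \<Rightarrow> 'i ell2" where
  "unit i = of_coords (\<lambda>j. if j = i then 1 else 0)"

lemma coord_unit: "coord (unit i) j = (if j = i then 1 else 0)"
proof -
  have "(\<lambda>j. (cmod (if j = i then 1 else 0))\<^sup>2) summable_on UNIV"
    by (subst summable_on_cong_neutral[where T = "{i}" and g = "\<lambda>_. 1"]) auto
  then show ?thesis unfolding unit_def by (subst coord_of_coords) simp_all
qed

lemma inner_unit: "inner x (unit i) = Re (coord x i)"
proof -
  have "inner x (unit i) = (\<Sum>\<^sub>\<infinity>j\<in>{i}. inner (coord x j) (coord (unit i) j))"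
    unfolding inner_ell2_def by (rule infsum_cong_neutral) (auto simp: coord_unit)
  then show ?thesis by (simp add: coord_unit inner_complex_def)
qed

lemma cip_unit: "cip x (unit i) = coord x i"
  using inner_unit[of x i] inner_unit[of "cmul \<i> x" i]
  by (simp add: cip_def complex_eq_iff inner_cmul_i_left)

definition permute :: "('i \<Rightarrow> 'i) \<Rightarrow> 'i ell2 \<Rightarrow> 'i ell2" where
  "permute p x = of_coords (\<lambda>i. coord x (p i))"

lemma coord_permute:
  assumes "bij p"
  shows "coord (permute p x) i = coord x (p i)"
proof -
  have "(\<lambda>i. (cmod (coord x (p i)))\<^sup>2) summable_on UNIV"
    using summable_coord[of x] summable_on_reindex_bij_betw[of p UNIV UNIV "\<lambda>i. (cmod (coord x i))\<^sup>2"] assms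
    by simp
  then show ?thesis unfolding permute_def by (subst coord_of_coords) simp_all
qed

lemma unitary_permute:
  assumes p: "bij p"
  shows "ell2.unitary (permute p)"
  unfolding ell2.unitary_def
proof (intro conjI allI)
  show "linear (permute p)"
    by (rule linearI) (auto intro!: ell2_eqI simp: coord_permute[OF p])
  show "norm (permute p x) = norm x" for x
    using has_sum_norm_ell2[of x] p
      has_sum_reindex_bij_betw[of p UNIV UNIV "\<lambda>i. (cmod (coord x i))\<^sup>2" "(norm x)\<^sup>2"]
    by (intro norm_ell2_eqI) (simp_all add: coord_permute[OF p])
  have "permute p (permute (inv p) x) = x" for x
    by (rule ell2_eqI)
      (simp add: coord_permute[OF p] coord_permute[OF bij_imp_bij_inv[OF p]] bij_is_inj[OF p])
  then show "surj (permute p)" by (rule surjI)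
qed (auto intro: ell2_eqI simp: coord_permute[OF p])

text \<open>\<open>permute\<close> pulls coordinates back, so j - 1 here moves the basis vector at
  (j, k) to (j + 1, k).\<close>

definition shift :: "(int \<times> int) ell2 \<Rightarrow> (int \<times> int) ell2" where
  "shift = permute (\<lambda>(j, k). (j - 1, k))"

lemma bij_shift: "bij (\<lambda>(j, k). (j - 1, k) :: int \<times> int)"
  by (rule bij_betw_byWitness[where f' = "\<lambda>(j, k). (j + 1, k)"]) auto

lemma coord_shift: "coord (shift x) (j, k) = coord x (j - 1, k)"
  by (simp add: shift_def coord_permute[OF bij_shift])

lemma unitary_shift: "ell2.unitary shift"
  unfolding shift_def by (rule unitary_permute[OF bij_shift])

lemma coord_inv_shift: "coord (inv shift x) (j, k) = coord x (j + 1, k)"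
  using coord_shift[of "inv shift x" "j + 1" k] by (simp add: unitary_shift)

lemma shift_unit: "shift (unit (j, k)) = unit (j + 1, k)"
proof (rule ell2_eqI)
  show "coord (shift (unit (j, k))) i = coord (unit (j + 1, k)) i" for i
    by (cases i) (auto simp: coord_shift coord_unit)
qed

section \<open>Extending an isometric copy of a representation to \<open>ell2\<close>\<close>

text \<open>For j <= 0 the relation gives T U^j = U^j T^(2^-j), so T moves the basis vector at (j,
  k) by 2^-j in the second index. For j > 0 the identity is a placeholder that keeps the map a
  permutation.\<close>

definition translate :: "(int \<times> int) ell2 \<Rightarrow> (int \<times> int) ell2" where
  "translate = permute (\<lambda>(j, k). (j, if j \<le> 0 then k - 2 ^ nat (- j) else k))"

lemma bij_translate: "bij (\<lambda>(j, k). (j, if j \<le> 0 then k - 2 ^ nat (- j) else k) :: int \<times> int)"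
  by (rule bij_betw_byWitness[where f' = "\<lambda>(j, k). (j, if j \<le> 0 then k + 2 ^ nat (- j) else k)"]) auto

lemma coord_translate:
  "coord (translate x) (j, k) = (if j \<le> 0 then coord x (j, k - 2 ^ nat (- j)) else coord x (j, k))"
  by (simp add: translate_def coord_permute[OF bij_translate])

lemma unitary_translate: "ell2.unitary translate"
  unfolding translate_def by (rule unitary_permute[OF bij_translate])

text \<open>The relation \<open>U T inv U = T\<^sup>2\<close> forces \<open>T\<close> to act as \<open>translate\<close> on the coordinates
  \<open>(j, k)\<close> with \<open>j \<le> 0\<close>. Together with the prescribed values on \<open>K\<close> this determines \<open>T\<close> on
  the orthogonal complement of \<open>W\<close>, and on \<open>W\<close> the initial choice is immaterial.\<close>
lemma exists_extension_ell2:
  fixes K :: "(int \<times> int) ell2 set" and t :: "(int \<times> int) ell2 \<Rightarrow> (int \<times> int) ell2"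
  assumes K: "subspace K" and K_i: "\<And>x. x \<in> K \<Longrightarrow> cmul \<i> x \<in> K"
    and K_shift: "\<And>x. x \<in> K \<Longrightarrow> shift x \<in> K" "\<And>x. x \<in> K \<Longrightarrow> inv shift x \<in> K"
    and t_add: "\<And>x y. x \<in> K \<Longrightarrow> y \<in> K \<Longrightarrow> t (x + y) = t x + t y"
    and t_scaleR: "\<And>r x. x \<in> K \<Longrightarrow> t (r *\<^sub>R x) = r *\<^sub>R t x"
    and t_i: "\<And>x. x \<in> K \<Longrightarrow> t (cmul \<i> x) = cmul \<i> (t x)"
    and t_norm: "\<And>x. x \<in> K \<Longrightarrow> norm (t x) = norm x"
    and t_image: "t ` K = K"
    and t_shift: "\<And>x. x \<in> K \<Longrightarrow> shift (t x) = t (t (shift x))"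
    and t_coord: "\<And>x k. x \<in> K \<Longrightarrow> coord (t x) (0, k) = coord x (0, k - 1)"
  shows "\<exists>A. ell2.unitary A \<and> (\<forall>x. shift (A (inv shift x)) = A (A x)) \<and> (\<forall>x\<in>K. A x = t x)
    \<and> (\<forall>k. A (unit (0, k)) = unit (0, k + 1))"
proof -
  note U = unitary_shift and D = unitary_translate
  note linU' = ell2.unitary_linear[OF ell2.unitary_inv[OF U]]
  note linU = ell2.unitary_linear[OF U] and linD = ell2.unitary_linear[OF D]
  have tK: "t x \<in> K" if "x \<in> K" for x using t_image that by blast
  \<comment> \<open>Level -(n + 1) of \<open>t x\<close> is level -n of \<open>shift (t x)\<close>,
    which equals \<open>t (t (shift x))\<close>: two translations by 2^n make one by 2^(n +
    1).\<close>
  have t_low: "coord (t x) (- int n, k) = coord x (- int n, k - 2 ^ n)" if "x \<in> K" for n x k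
    using that
  proof (induction n arbitrary: x k)
    case (Suc n)
    have Suc_n: "- int (Suc n) = - int n - 1" by simp
    have "coord (t x) (- int (Suc n), k) = coord (shift (t x)) (- int n, k)"
      by (simp only: coord_shift Suc_n)
    also have "\<dots> = coord (shift x) (- int n, k - 2 ^ n - 2 ^ n)"
      using Suc.prems by (simp add: t_shift Suc.IH tK K_shift)
    also have "\<dots> = coord x (- int (Suc n), k - 2 ^ Suc n)"
      unfolding coord_shift Suc_n by simp
    finally show ?case .
  qed (simp add: t_coord)
  have t_translate: "coord (t x) (j, k) = coord (translate x) (j, k)" if "x \<in> K" "j \<le> 0" for x j k
    using t_low[OF that(1), of "nat (- j)" k] that(2) by (simp add: coord_translate)
  define L where "L = {x :: (int \<times> int) ell2. \<forall>j k. 0 < j \<longrightarrow> coord x (j, k) = 0}"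
  have L: "subspace L" by (simp add: L_def subspace_def)
  have L_i: "cmul \<i> x \<in> L" if "x \<in> L" for x using that by (simp add: L_def)
  have L_D: "translate x \<in> L" if "x \<in> L" for x using that by (simp add: L_def coord_translate)
  have L_D': "inv translate x \<in> L" if "x \<in> L" for x
  proof -
    have "coord (inv translate x) (j, k) = 0" if "0 < j" for j k
      using \<open>x \<in> L\<close> coord_translate[of "inv translate x" j k] that by (simp add: L_def D)
    then show ?thesis by (simp add: L_def)
  qed
  have L_U': "inv shift x \<in> L" if "x \<in> L" for x using that by (simp add: L_def coord_inv_shift)
  have unit_L: "unit (j, k) \<in> L" if "j \<le> 0" for j k using that by (auto simp: L_def coord_unit)
  define W where "W = {w. (\<forall>h\<in>K. inner h w = 0) \<and> (\<forall>x\<in>L. inner x w = 0)}"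
  have W: "subspace W" by (simp add: W_def subspace_def inner_add_right)
  have "closed W"
  proof -
    have "W = (\<Inter>h\<in>K \<union> L. {w. inner h w = 0})" by (auto simp: W_def)
    then show ?thesis by (auto intro!: closed_INT closed_Collect_eq continuous_intros)
  qed
  moreover have W_i: "cmul \<i> w \<in> W" if "w \<in> W" for w
    using that K_i L_i inner_cmul_i_left[of _ w] by (force simp: W_def)
  ultimately obtain P where P: "ell2.projection P" and P_W: "\<And>x. x - P x \<in> W" "\<And>w. w \<in> W \<Longrightarrow> P w = 0"
    and P_eq: "\<And>x. (\<forall>w\<in>W. inner x w = 0) \<Longrightarrow> P x = x" and P_orth: "\<And>x w. w \<in> W \<Longrightarrow> inner (P x) w = 0"
    using ell2.exists_projection[OF W] by blast
  have P_KL: "P (h + x) = h + x" if "h \<in> K" "x \<in> L" for h x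
    by (rule P_eq) (use that in \<open>simp add: W_def inner_add_left\<close>)
  have W_low: "coord w (j, k) = 0" if "w \<in> W" "j \<le> 0" for w j k
  proof -
    \<comment> \<open>The real inner product with a basis vector sees only the real part of a
      coordinate; the imaginary part comes from applying this to \<open>cmul \<i> w\<close>.\<close>
    have low: "Re (coord v (j, k)) = 0" if "v \<in> W" for v
      using that unit_L[OF \<open>j \<le> 0\<close>, of k] by (auto simp: W_def inner_commute simp flip: inner_unit)
    from low[OF W_i[OF that(1)]] low[OF that(1)] show ?thesis by (simp add: complex_eq_iff)
  qed
  have WI: "w \<in> W" if "\<forall>h\<in>K. inner h w = 0" "\<And>j k. j \<le> 0 \<Longrightarrow> coord w (j, k) = 0" for w
  proof -
    have "inner x w = 0" if "x \<in> L" for x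
    proof -
      have "inner (coord x i) (coord w i) = 0" for i
        using that \<open>\<And>j k. j \<le> 0 \<Longrightarrow> coord w (j, k) = 0\<close>[of "fst i" "snd i"]
        by (cases i; cases "fst i \<le> 0") (auto simp: L_def)
      then show ?thesis by (simp add: inner_ell2_def)
    qed
    with that(1) show ?thesis by (simp add: W_def)
  qed
  \<comment> \<open>The inclusion of V0 in U V0, read on orthogonal complements.\<close>
  have W_U: "shift w \<in> W" if "w \<in> W" for w
  proof (rule WI)
    show "\<forall>h\<in>K. inner h (shift w) = 0"
      using that K_shift(2) ell2.unitary_inner_inv[OF U, of w] by (auto simp: W_def inner_commute)
    show "coord (shift w) (j, k) = 0" if "j \<le> 0" for j k
      using that \<open>w \<in> W\<close> by (simp add: coord_shift W_low)
  qed
  \<comment> \<open>The two prescriptions are compatible: \<open>translate x\<close> lives on levels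
    j <= 0, where \<open>t h\<close> coincides with \<open>translate h\<close>, so the pairing
    reduces to unitarity of \<open>translate\<close>.\<close>
  have cross: "inner (t h) (translate x) = inner h x" if "h \<in> K" "x \<in> L" for h x
  proof -
    have "inner (coord (t h) i) (coord (translate x) i)
        = inner (coord (translate h) i) (coord (translate x) i)" for i
      using t_translate[OF that(1), of "fst i" "snd i"] L_D[OF that(2)]
      by (cases i; cases "fst i \<le> 0") (auto simp: L_def)
    then have "inner (t h) (translate x) = inner (translate h) (translate x)"
      by (simp add: inner_ell2_def)
    then show ?thesis by (simp add: ell2.unitary_inner[OF D])
  qed
  define G where "G = {(h + x + w, t h + translate x + w) | h x w. h \<in> K \<and> x \<in> L \<and> w \<in> W}"
  have G_dom: "y = 0" if y: "\<And>h x w. h \<in> K \<Longrightarrow> x \<in> L \<Longrightarrow> w \<in> W \<Longrightarrow> inner (h + x + w) y = 0" for y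
  proof -
    have "y \<in> W"
      using y[OF _ subspace_0[OF L] subspace_0[OF W]] y[OF subspace_0[OF K] _ subspace_0[OF W]]
      by (simp add: W_def)
    then show ?thesis
      using y[OF subspace_0[OF K] subspace_0[OF L], of y] by simp
  qed
  have t_0: "t 0 = 0" using t_scaleR[OF subspace_0[OF K], of 0] by simp
  have "\<exists>A. ell2.unitary A \<and> (\<forall>a b. (a, b) \<in> G \<longrightarrow> A a = b)"
  proof (rule ell2.unitary_from_dense_graph)
    show "subspace G"
    proof (rule subspaceI)
      show "0 \<in> G"
        unfolding G_def zero_prod_def
        by (intro CollectI exI[of _ 0])
          (simp add: t_0 linear_0[OF linD] subspace_0 K L W)
    next
      fix p q assume "p \<in> G" "q \<in> G"
      then obtain h x w h' x' w' where "h \<in> K" "x \<in> L" "w \<in> W" "h' \<in> K" "x' \<in> L" "w' \<in> W"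
        "p = (h + x + w, t h + translate x + w)" "q = (h' + x' + w', t h' + translate x' + w')"
        unfolding G_def by blast
      then show "p + q \<in> G"
        unfolding G_def
        by (intro CollectI exI[of _ "h + h'"] exI[of _ "x + x'"] exI[of _ "w + w'"])
          (simp add: t_add linear_add[OF linD] subspace_add K L W algebra_simps)
    next
      fix c :: real and p assume "p \<in> G"
      then obtain h x w where "h \<in> K" "x \<in> L" "w \<in> W" "p = (h + x + w, t h + translate x + w)"
        unfolding G_def by blast
      then show "c *\<^sub>R p \<in> G"
        unfolding G_def
        by (intro CollectI exI[of _ "c *\<^sub>R h"] exI[of _ "c *\<^sub>R x"] exI[of _ "c *\<^sub>R w"])
          (simp add: t_scaleR linear_scale[OF linD] subspace_scale K L W scaleR_add_right)
    qed
    show "norm a = norm b" if ab: "(a, b) \<in> G" for a b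
    proof -
      obtain h x w where hxw: "h \<in> K" "x \<in> L" "w \<in> W" "a = h + x + w" "b = t h + translate x + w"
        using ab unfolding G_def by blast
      have "inner (h + x) w = 0" "inner (t h + translate x) w = 0"
        using hxw tK L_D by (simp_all add: W_def inner_add_left)
      then have "(norm a)\<^sup>2 = (norm (h + x))\<^sup>2 + (norm w)\<^sup>2"
        "(norm b)\<^sup>2 = (norm (t h + translate x))\<^sup>2 + (norm w)\<^sup>2"
        unfolding hxw(4,5) by (simp_all only: norm_add_Pythagorean orthogonal_def)
      moreover have "inner (t h) (t h) = inner h h"
        using t_norm[OF hxw(1)] by (simp add: norm_eq_sqrt_inner)
      then have "(norm (t h + translate x))\<^sup>2 = (norm (h + x))\<^sup>2"
        using cross[OF hxw(1,2)]
        by (simp add: power2_norm_eq_inner inner_add_left inner_add_right ell2.unitary_inner[OF D]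
            inner_commute[of "translate x" "t h"] inner_commute[of x h])
      ultimately have "(norm a)\<^sup>2 = (norm b)\<^sup>2" by simp
      then show ?thesis by simp
    qed
    show "(cmul \<i> a, cmul \<i> b) \<in> G" if ab: "(a, b) \<in> G" for a b
    proof -
      obtain h x w where "h \<in> K" "x \<in> L" "w \<in> W" "a = h + x + w" "b = t h + translate x + w"
        using ab unfolding G_def by blast
      then show ?thesis
        unfolding G_def
        by (intro CollectI exI[of _ "cmul \<i> h"] exI[of _ "cmul \<i> x"] exI[of _ "cmul \<i> w"])
          (simp add: t_i K_i L_i W_i ell2.unitary_J[OF D] linear_add[OF ell2.linear_J])
    qed
    show "y = 0" if y: "\<And>a b. (a, b) \<in> G \<Longrightarrow> inner a y = 0" for y
      by (rule G_dom, rule y) (auto simp: G_def)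
    show "y = 0" if y: "\<And>a b. (a, b) \<in> G \<Longrightarrow> inner b y = 0" for y
    proof (rule G_dom)
      fix h x w assume hxw: "h \<in> K" "x \<in> L" "w \<in> W"
      obtain h' where h': "h' \<in> K" "h = t h'" using hxw(1) t_image by blast
      have "(h' + inv translate x + w, t h' + translate (inv translate x) + w) \<in> G"
        unfolding G_def using hxw h' L_D' by blast
      from y[OF this] show "inner (h + x + w) y = 0" by (simp add: h' D)
    qed
  qed
  then obtain A where A: "ell2.unitary A" and A_G: "\<And>a b. (a, b) \<in> G \<Longrightarrow> A a = b" by blast
  have A_eq: "A (h + x + w) = t h + translate x + w" if "h \<in> K" "x \<in> L" "w \<in> W" for h x w
    by (rule A_G) (use that in \<open>auto simp: G_def\<close>)
  have A_KL: "A (h + x) = t h + translate x" if "h \<in> K" "x \<in> L" for h x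
    using A_eq[OF that subspace_0[OF W]] by simp
  have A_W: "A w = w" if "w \<in> W" for w
    using A_eq[OF subspace_0[OF K] subspace_0[OF L] that] by (simp add: t_0 linear_0[OF linD])
  have AP: "A (P y) = P (A y)" for y
  proof -
    have "inner (A (P y)) w = 0" if "w \<in> W" for w
      using ell2.unitary_inner[OF A, of "P y" w] A_W[OF that] P_orth[OF that] by simp
    then have "P (A (P y)) = A (P y)" by (intro P_eq) blast
    moreover have "P (A (y - P y)) = 0" using P_W A_W by simp
    ultimately show ?thesis
      by (simp add: linear_diff[OF ell2.unitary_linear[OF A]] linear_diff[OF ell2.projection_linear[OF P]])
  qed
  have UDU: "shift (translate (inv shift x)) = translate (translate x)" if "x \<in> L" for x
  proof (rule ell2_eqI)
    fix i :: "int \<times> int"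
    obtain j k where i: "i = (j, k)" by (cases i)
    \<comment> \<open>At j = 1 the left side translates by 1 and the right side does not move
      anything; there \<open>L\<close> is needed to make both vanish.\<close>
    consider "j \<le> 0" | "j = 1" | "1 < j" by linarith
    then show "coord (shift (translate (inv shift x))) i = coord (translate (translate x)) i"
    proof cases
      case 1
      then have "nat (1 - j) = Suc (nat (- j))" by simp
      with 1 show ?thesis by (simp add: i coord_shift coord_inv_shift coord_translate)
    qed (use that in \<open>simp_all add: i coord_shift coord_inv_shift coord_translate L_def\<close>)
  qed
  have "\<exists>A'. ell2.unitary A' \<and> (\<forall>x. shift (A' (inv shift x)) = A' (A' x)) \<and> (\<forall>x. A' (P x) = A (P x))"
  proof (rule ell2.unitary_extension[OF U A P AP])
    show "shift (A (inv shift (P y))) = A (A (P y))" for y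
    proof (rule bounded_linear_eqI[of "\<lambda>y. shift (A (inv shift (P y)))" "\<lambda>y. A (A (P y))"])
      note bl = ell2.unitary_bounded_linear and PB = ell2.projection_bounded_linear[OF P]
      show "bounded_linear (\<lambda>y. shift (A (inv shift (P y))))" "bounded_linear (\<lambda>y. A (A (P y)))"
        using bounded_linear_compose[OF bl[OF U] bounded_linear_compose[OF bl[OF A]
              bounded_linear_compose[OF bl[OF ell2.unitary_inv[OF U]] PB]]]
          bounded_linear_compose[OF bl[OF A] bounded_linear_compose[OF bl[OF A] PB]]
        by blast+
      show "z = 0" if z: "\<And>y. shift (A (inv shift (P y))) = A (A (P y)) \<Longrightarrow> inner y z = 0" for z
      proof (rule G_dom, rule z)
        fix h x w assume hxw: "h \<in> K" "x \<in> L" "w \<in> W"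
        have "P (h + x + w) = h + x"
          using P_KL[OF hxw(1,2)] P_W(2)[OF hxw(3)]
          by (simp add: linear_add[OF ell2.projection_linear[OF P], of "h + x"])
        moreover have "shift (A (inv shift (h + x))) = A (A (h + x))"
          using hxw t_shift[OF K_shift(2)[OF hxw(1)]]
          by (simp add: linear_add[OF linU'] linear_add[OF linU] A_KL K_shift L_U' UDU tK L_D U)
        ultimately show "shift (A (inv shift (P (h + x + w)))) = A (A (P (h + x + w)))" by simp
      qed
    qed
    show "shift (P (inv shift (P x))) = P x" for x
    proof -
      have "P (inv shift (P x)) = inv shift (P x)"
      proof (rule P_eq, rule ballI)
        show "inner (inv shift (P x)) w = 0" if "w \<in> W" for w
          using P_orth[OF W_U[OF that], of x] ell2.unitary_inner_inv[OF U, of w "P x"]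
          by (simp add: inner_commute)
      qed
      then show ?thesis by (simp add: U)
    qed
    show "y = 0" if y: "\<And>n. P ((inv shift ^^ n) y) = 0" for y
    proof (rule ell2_eqI)
      fix i :: "int \<times> int"
      obtain j k where i: "i = (j, k)" by (cases i)
      have coord_pow: "coord ((inv shift ^^ n) y) (j, k) = coord y (j + int n, k)" for n j k
        by (induction n arbitrary: j) (simp_all add: coord_inv_shift algebra_simps)
      \<comment> \<open>Shifting down \<open>nat j\<close> times brings the coordinate (j, k) to
        level min j 0, where all vectors of \<open>W\<close> vanish.\<close>
      have "(inv shift ^^ nat j) y \<in> W" using P_W(1)[of "(inv shift ^^ nat j) y"] y by simp
      then have "coord y (min j 0 + int (nat j), k) = 0"
        using W_low[of "(inv shift ^^ nat j) y" "min j 0" k] coord_pow[of "nat j" "min j 0" k] by simp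
      moreover have "min j 0 + int (nat j) = j" by simp
      ultimately show "coord y i = coord 0 i" by (simp add: i)
    qed
  qed
  then obtain A' where A': "ell2.unitary A'" "\<And>x. shift (A' (inv shift x)) = A' (A' x)"
    and A'_P: "\<And>x. A' (P x) = A (P x)" by blast
  have A'_KL: "A' (h + x) = t h + translate x" if "h \<in> K" "x \<in> L" for h x
    using A'_P[of "h + x"] by (simp add: P_KL A_KL that)
  have "A' x = t x" if "x \<in> K" for x
    using A'_KL[OF that subspace_0[OF L]] by (simp add: linear_0[OF linD])
  moreover have "A' (unit (0, k)) = unit (0, k + 1)" for k
  proof -
    have "A' (unit (0, k)) = translate (unit (0, k))"
      using A'_KL[OF subspace_0[OF K] unit_L[of 0 k]] by (simp add: t_0)
    also have "\<dots> = unit (0, k + 1)"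
    proof (rule ell2_eqI)
      show "coord (translate (unit (0, k))) i = coord (unit (0, k + 1)) i" for i
        by (cases i) (auto simp: coord_translate coord_unit)
    qed
    finally show ?thesis .
  qed
  ultimately show ?thesis using A' by blast
qed

section \<open>Direct sums of representations\<close>

lemma bij_betw_opsum:
  assumes "bij_betw A (hcarrier H) (hcarrier H)" "bij_betw B (hcarrier K) (hcarrier K)"
  shows "bij_betw (opsum A B) (hcarrier (hsum H K)) (hcarrier (hsum H K))"
  using bij_betw_map_prod[OF assms] by (simp add: opsum_def hsum_def map_prod_def)

text \<open>Removes the inverse, so that the relation on a direct sum can be checked componentwise
  without computing the inverse of \<open>opsum\<close>.\<close>

lemma bs12_relation_iff:
  assumes U: "bij_betw U C C"
    and T: "\<And>x. x \<in> C \<Longrightarrow> T x \<in> C"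
  shows "(\<forall>x\<in>C. U (T (inv_into C U x)) = T (T x)) \<longleftrightarrow> (\<forall>x\<in>C. U (T x) = T (T (U x)))"
proof -
  have "inv_into C U (U x) = x" "U (inv_into C U x) = x" "U x \<in> C" "inv_into C U x \<in> C"
    if "x \<in> C" for x
    using that U bij_betw_inv_into[OF U]
    by (auto simp: bij_betw_inv_into_left bij_betw_inv_into_right dest: bij_betwE)
  then show ?thesis by metis
qed

lemma unitary_op_bij: "unitary_op H A \<Longrightarrow> bij_betw A (hcarrier H) (hcarrier H)"
  and unitary_op_closed: "unitary_op H A \<Longrightarrow> x \<in> hcarrier H \<Longrightarrow> A x \<in> hcarrier H"
  and unitary_op_add: "unitary_op H A \<Longrightarrow> x \<in> hcarrier H \<Longrightarrow> y \<in> hcarrier H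
    \<Longrightarrow> A (hadd H x y) = hadd H (A x) (A y)"
  and unitary_op_scale: "unitary_op H A \<Longrightarrow> x \<in> hcarrier H \<Longrightarrow> A (hscale H a x) = hscale H a (A x)"
  and unitary_op_ip: "unitary_op H A \<Longrightarrow> x \<in> hcarrier H \<Longrightarrow> y \<in> hcarrier H
    \<Longrightarrow> hip H (A x) (A y) = hip H x y"
  by (auto simp: unitary_op_def hlinear_def dest: bij_betwE)

lemma unitary_op_opsum:
  assumes "unitary_op H A" "unitary_op K B"
  shows "unitary_op (hsum H K) (opsum A B)"
  using bij_betw_opsum[OF unitary_op_bij[OF assms(1)] unitary_op_bij[OF assms(2)]] assms
  by (auto simp: unitary_op_def hlinear_def hsum_def opsum_def)

lemma bs12_rep_iff:
  "bs12_rep H U T \<longleftrightarrow> unitary_op H U \<and> unitary_op H T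
    \<and> (\<forall>x\<in>hcarrier H. U (T x) = T (T (U x)))"
proof (cases "unitary_op H U \<and> unitary_op H T")
  case True
  then have "bij_betw U (hcarrier H) (hcarrier H)" "\<And>x. x \<in> hcarrier H \<Longrightarrow> T x \<in> hcarrier H"
    by (simp_all add: unitary_op_bij unitary_op_closed)
  from bs12_relation_iff[OF this] True show ?thesis by (simp add: bs12_rep_def)
qed (auto simp: bs12_rep_def)

lemma bs12_rep_opsum:
  assumes "bs12_rep H U T" "bs12_rep K U' T'"
  shows "bs12_rep (hsum H K) (opsum U U') (opsum T T')"
  using assms unitary_op_opsum unfolding bs12_rep_iff
  by (auto simp: opsum_def hsum_def)

section \<open>Integer powers and wavelet systems\<close>

lemma opow_0: "opow H A 0 x = x"
  by (simp add: opow_def)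

lemma opow_closed:
  assumes A: "bij_betw A (hcarrier H) (hcarrier H)" and x: "x \<in> hcarrier H"
  shows "opow H A j x \<in> hcarrier H"
proof -
  have "(B ^^ n) x \<in> hcarrier H" if "bij_betw B (hcarrier H) (hcarrier H)" for B n
    using that x by (induction n) (auto dest: bij_betwE)
  then show ?thesis using A bij_betw_inv_into[OF A] by (simp add: opow_def)
qed

lemma opow_add_1:
  assumes A: "bij_betw A (hcarrier H) (hcarrier H)" and x: "x \<in> hcarrier H"
  shows "opow H A (j + 1) x = A (opow H A j x)"
proof (cases "0 \<le> j")
  case True
  then show ?thesis by (simp add: opow_def nat_add_distrib)
next
  case False
  then have "nat (- j) = Suc (nat (- (j + 1)))" by simp
  moreover have "(inv_into (hcarrier H) A ^^ nat (- (j + 1))) x = opow H A (j + 1) x"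
    using False by (cases "j = - 1") (simp_all add: opow_def)
  ultimately have "opow H A j x = inv_into (hcarrier H) A (opow H A (j + 1) x)"
    using False by (simp add: opow_def)
  then show ?thesis
    using bij_betw_inv_into_right[OF A opow_closed[OF A x]] by simp
qed

text \<open>Injectivity of \<open>A\<close> lets the forward recursion determine \<open>f\<close> at
  negative indices too. Wavelet systems are identified this way from a closed form, without handling
  inverse powers.\<close>

lemma opow_unique:
  assumes A: "bij_betw A (hcarrier H) (hcarrier H)"
    and f: "\<And>j. f j \<in> hcarrier H" "\<And>j. f (j + 1) = A (f j)"
  shows "opow H A j (f 0) = f j"
proof (induction j rule: int_induct[where k = 0])
  case (step1 j)
  then show ?case by (simp add: opow_add_1[OF A f(1)] f(2))
next
  case (step2 j)
  have "A (opow H A (j - 1) (f 0)) = A (f (j - 1))"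
    using opow_add_1[OF A f(1), of "j - 1" 0] f(2)[of "j - 1"] step2 by simp
  then show ?case
    using bij_betw_imp_inj_on[OF A] opow_closed[OF A f(1)] f(1) by (blast dest: inj_onD)
qed (rule opow_0)

lemma wavelet_system_unique:
  assumes U: "bij_betw U (hcarrier H) (hcarrier H)" and T: "bij_betw T (hcarrier H) (hcarrier H)"
    and f: "\<And>j k. f (j, k) \<in> hcarrier H" "\<And>j k. f (j + 1, k) = U (f (j, k))"
      "\<And>k. f (0, k + 1) = T (f (0, k))"
  shows "wavelet_system H U T (f (0, 0)) = f"
proof (rule ext)
  fix i :: "int \<times> int"
  obtain j k where i: "i = (j, k)" by (cases i)
  have "opow H T k (f (0, 0)) = f (0, k)"
    using opow_unique[OF T, of "\<lambda>k. f (0, k)"] f by simp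
  moreover have "opow H U j (f (0, k)) = f (j, k)"
    using opow_unique[OF U, of "\<lambda>j. f (j, k)"] f by simp
  ultimately show "wavelet_system H U T (f (0, 0)) i = f i"
    by (simp add: wavelet_system_def i)
qed

section \<open>Closed complex subspaces of \<open>ell2\<close> as Hilbert spaces\<close>

text \<open>Vectors are coordinate functions because the theorem asks for a space on that type;
  \<open>of_coords\<close> is applied only to functions in the image of \<open>coord\<close> as long
  as arguments stay in the carrier.\<close>

definition sub_ell2 :: "'i ell2 set \<Rightarrow> ('i \<Rightarrow> complex) chs" where
  "sub_ell2 W = \<lparr> hcarrier = coord ` W, hadd = (\<lambda>f g i. f i + g i), hscale = (\<lambda>c f i. c * f i),
     hzero = (\<lambda>_. 0), hip = (\<lambda>f g. cip (of_coords f) (of_coords g)) \<rparr>"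

lemma sub_ell2_simps:
  "hcarrier (sub_ell2 W) = coord ` W"
  "hadd (sub_ell2 W) (coord x) (coord y) = coord (x + y)"
  "hscale (sub_ell2 W) c (coord x) = coord (cmul c x)"
  "hzero (sub_ell2 W) = coord 0"
  "hip (sub_ell2 W) (coord x) (coord y) = cip x y"
  "hdiff (sub_ell2 W) (coord x) (coord y) = coord (x - y)"
  "hnorm (sub_ell2 W) (coord x) = norm x"
  by (simp_all add: sub_ell2_def hdiff_def hnorm_def coord_inverse cip_self fun_eq_iff)

lemma complex_hilbert_space_sub_ell2:
  assumes W: "subspace W" "closed W" and W_i: "\<And>x. x \<in> W \<Longrightarrow> cmul \<i> x \<in> W"
  shows "complex_hilbert_space (sub_ell2 W)"
proof -
  have W_c: "cmul c x \<in> W" if "x \<in> W" for c x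
    unfolding cmul_eq[of c] by (intro subspace_add subspace_scale W W_i that)
  have complete: "\<exists>x\<in>coord ` W. (\<lambda>n. hnorm (sub_ell2 W) (hdiff (sub_ell2 W) (f n) x)) \<longlonglongrightarrow> 0"
    if f: "\<forall>n. f n \<in> coord ` W"
      and cauchy: "\<forall>e>0. \<exists>N. \<forall>m\<ge>N. \<forall>n\<ge>N. hnorm (sub_ell2 W) (hdiff (sub_ell2 W) (f m) (f n)) < e"
    for f :: "nat \<Rightarrow> 'a \<Rightarrow> complex"
  proof -
    have "\<forall>n. \<exists>x. x \<in> W \<and> f n = coord x" using f by blast
    then obtain X where X: "\<And>n. X n \<in> W" "\<And>n. f n = coord (X n)" by metis
    have "Cauchy X" using cauchy by (simp add: Cauchy_iff X(2) sub_ell2_simps)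
    then obtain x where x: "X \<longlonglongrightarrow> x" by (auto simp: Cauchy_convergent_iff convergent_def)
    have "x \<in> W" using closed_sequentially[OF W(2) _ x] X(1) by blast
    moreover have "(\<lambda>n. norm (X n - x)) \<longlonglongrightarrow> 0" using x LIM_zero tendsto_norm_zero by blast
    ultimately show ?thesis by (auto simp: X(2) sub_ell2_simps)
  qed
  have neg: "\<exists>y\<in>coord ` W. hadd (sub_ell2 W) (coord x) y = coord 0" if "x \<in> W" for x
    by (rule bexI[of _ "coord (- x)"]) (use that subspace_neg[OF W(1)] in \<open>auto simp: sub_ell2_simps\<close>)
  have cmul_distrib: "cmul a (x + y) = cmul a x + cmul a y" "cmul (a + b) x = cmul a x + cmul b x"
    "cmul (a * b) x = cmul a (cmul b x)" "cmul 1 x = x" for a b and x y :: "'a ell2"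
    by (auto intro!: ell2_eqI simp: algebra_simps)
  show ?thesis
    unfolding complex_hilbert_space_def
    using complete neg subspace_0[OF W(1)] subspace_add[OF W(1)] W_c cip_cnj
    by (auto simp: sub_ell2_simps cmul_distrib cip_add_left cip_cmul_left cip_self add.assoc
        add.commute image_iff coord_inject)
qed

lemma unitary_op_sub_ell2:
  assumes A: "ell2.unitary A" and inv: "\<And>x. x \<in> W \<Longrightarrow> A x \<in> W" "\<And>x. x \<in> W \<Longrightarrow> inv A x \<in> W"
  shows "unitary_op (sub_ell2 W) (\<lambda>f. coord (A (of_coords f)))"
proof -
  have "bij_betw (\<lambda>f. coord (A (of_coords f))) (coord ` W) (coord ` W)"
    by (rule bij_betw_byWitness[where f' = "\<lambda>f. coord (inv A (of_coords f))"])
      (auto simp: coord_inverse A inv)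
  then show ?thesis
    unfolding unitary_op_def hlinear_def
    by (auto simp: sub_ell2_simps coord_inverse unitary_cip[OF A] unitary_cmul[OF A]
        linear_add[OF ell2.unitary_linear[OF A]])
qed

section \<open>The analysis operator of a Parseval frame\<close>

definition analysis :: "'v chs \<Rightarrow> ('i \<Rightarrow> 'v) \<Rightarrow> 'v \<Rightarrow> 'i ell2" where
  "analysis H e h = of_coords (\<lambda>i. hip H h (e i))"

locale complex_parseval_frame =
  fixes H :: "'v chs" and e :: "'i \<Rightarrow> 'v"
  assumes hilbert: "complex_hilbert_space H" and frame: "parseval_frame H e"
begin

abbreviation "C \<equiv> hcarrier H"
abbreviation "\<Theta> \<equiv> analysis H e"

lemma zero_closed: "hzero H \<in> C"
  and add_closed: "x \<in> C \<Longrightarrow> y \<in> C \<Longrightarrow> hadd H x y \<in> C"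
  and scale_closed: "x \<in> C \<Longrightarrow> hscale H a x \<in> C"
  and ip_add_left: "x \<in> C \<Longrightarrow> y \<in> C \<Longrightarrow> z \<in> C \<Longrightarrow> hip H (hadd H x y) z = hip H x z + hip H y z"
  and ip_scale_left: "x \<in> C \<Longrightarrow> y \<in> C \<Longrightarrow> hip H (hscale H a x) y = a * hip H x y"
  and ip_cnj: "x \<in> C \<Longrightarrow> y \<in> C \<Longrightarrow> hip H y x = cnj (hip H x y)"
  and ip_self: "x \<in> C \<Longrightarrow> Im (hip H x x) = 0" "x \<in> C \<Longrightarrow> 0 \<le> Re (hip H x x)"
  and ip_self_eq_0: "x \<in> C \<Longrightarrow> hip H x x = 0 \<Longrightarrow> x = hzero H"
  by (insert hilbert[unfolded complex_hilbert_space_def]) (blast | metis)+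

lemma e_closed: "e i \<in> C"
  using frame by (simp add: parseval_frame_def)

lemma ip_add_right: "x \<in> C \<Longrightarrow> y \<in> C \<Longrightarrow> z \<in> C \<Longrightarrow> hip H x (hadd H y z) = hip H x y + hip H x z"
  by (metis add_closed complex_cnj_add ip_add_left ip_cnj)

lemma frame_sum: "h \<in> C \<Longrightarrow> ((\<lambda>i. (cmod (hip H h (e i)))\<^sup>2) has_sum (hnorm H h)\<^sup>2) UNIV"
  using frame by (simp add: parseval_frame_def)

lemma coord_analysis: "h \<in> C \<Longrightarrow> coord (\<Theta> h) i = hip H h (e i)"
  unfolding analysis_def by (subst coord_of_coords) (auto intro: has_sum_imp_summable frame_sum)

lemma norm_analysis: "h \<in> C \<Longrightarrow> norm (\<Theta> h) = hnorm H h"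
  using frame_sum by (intro norm_ell2_eqI) (simp_all add: coord_analysis hnorm_def ip_self)

lemma analysis_add: "x \<in> C \<Longrightarrow> y \<in> C \<Longrightarrow> \<Theta> (hadd H x y) = \<Theta> x + \<Theta> y"
  by (rule ell2_eqI) (simp add: coord_analysis add_closed e_closed ip_add_left)

lemma analysis_scale: "x \<in> C \<Longrightarrow> \<Theta> (hscale H a x) = cmul a (\<Theta> x)"
  by (rule ell2_eqI) (simp add: coord_analysis scale_closed e_closed ip_scale_left)

lemma analysis_scaleR: "x \<in> C \<Longrightarrow> \<Theta> (hscale H (complex_of_real r) x) = r *\<^sub>R \<Theta> x"
  by (rule ell2_eqI) (simp add: analysis_scale)

lemma analysis_diff: "x \<in> C \<Longrightarrow> y \<in> C \<Longrightarrow> \<Theta> (hdiff H x y) = \<Theta> x - \<Theta> y"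
  by (rule ell2_eqI) (simp add: hdiff_def analysis_add analysis_scale scale_closed)

lemma hdiff_closed: "x \<in> C \<Longrightarrow> y \<in> C \<Longrightarrow> hdiff H x y \<in> C"
  by (simp add: hdiff_def add_closed scale_closed)

text \<open>Polarization of \<open>norm_analysis\<close>, using the norms of x, y and their
  sum.\<close>

lemma inner_analysis:
  assumes "x \<in> C" "y \<in> C"
  shows "inner (\<Theta> x) (\<Theta> y) = Re (hip H x y)"
proof -
  have norm_sq: "inner (\<Theta> h) (\<Theta> h) = Re (hip H h h)" if "h \<in> C" for h
    using norm_analysis[OF that] by (simp add: norm_eq_sqrt_inner hnorm_def)
  have "Re (hip H y x) = Re (hip H x y)" using ip_cnj[OF assms] by simp
  then show ?thesis
    using norm_sq[OF add_closed[OF assms]] norm_sq[OF assms(1)] norm_sq[OF assms(2)] assms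
    by (simp add: analysis_add inner_add_left inner_add_right ip_add_left ip_add_right add_closed
        inner_commute[of "\<Theta> y" "\<Theta> x"])
qed

lemma subspace_range_analysis: "subspace (\<Theta> ` C)"
proof (rule subspaceI)
  show "0 \<in> \<Theta> ` C"
    using analysis_scaleR[OF zero_closed, of 0] scale_closed[OF zero_closed]
    by (metis image_eqI scaleR_zero_left)
qed (auto simp flip: analysis_add analysis_scaleR intro: add_closed scale_closed)

lemma analysis_eq_0: "x \<in> C \<Longrightarrow> \<Theta> x = 0 \<Longrightarrow> x = hzero H"
  using inner_analysis[of x x] ip_self[of x] by (intro ip_self_eq_0) (simp_all add: complex_eq_iff)

text \<open>\<open>T\<close> preserves the norm of the difference of x and y, which
  \<open>\<Theta>\<close> reflects. Hence the operator transported to the range of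
  \<open>\<Theta>\<close> does not depend on the chosen preimage.\<close>

lemma unitary_op_analysis_cong:
  assumes T: "unitary_op H T" and xy: "x \<in> C" "y \<in> C" "\<Theta> x = \<Theta> y"
  shows "\<Theta> (T x) = \<Theta> (T y)"
proof -
  have "T (hdiff H x y) = hdiff H (T x) (T y)"
    using T xy by (simp add: hdiff_def unitary_op_add unitary_op_scale scale_closed)
  moreover have "norm (\<Theta> (T (hdiff H x y))) = norm (\<Theta> (hdiff H x y))"
    using T hdiff_closed[OF xy(1,2)] by (simp add: norm_analysis hnorm_def unitary_op_ip unitary_op_closed)
  ultimately show ?thesis using T xy by (simp add: analysis_diff unitary_op_closed)
qed

end

theorem theorem2p6:
  fixes H :: "'v chs" and U T :: "'v \<Rightarrow> 'v" and \<psi> :: 'v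
  assumes "complex_hilbert_space H"
    and "bs12_rep H U T"
    and "parseval_wavelet H U T \<psi>"
  shows "\<exists>(H2 :: (int \<times> int \<Rightarrow> complex) chs) U2 T2 \<psi>2.
           complex_hilbert_space H2 \<and> bs12_rep H2 U2 T2 \<and> parseval_wavelet H2 U2 T2 \<psi>2 \<and>
           bs12_rep (hsum H H2) (opsum U U2) (opsum T T2) \<and>
           orthonormal_wavelet (hsum H H2) (opsum U U2) (opsum T T2) (\<psi>, \<psi>2)"
proof -
  define e where "e = wavelet_system H U T \<psi>"
  interpret complex_parseval_frame H e
    using assms by unfold_locales (simp_all add: e_def parseval_wavelet_def)
  have U: "unitary_op H U" and T: "unitary_op H T" and UT: "\<And>x. x \<in> C \<Longrightarrow> U (T x) = T (T (U x))"
    using assms(2) by (simp_all add: bs12_rep_iff)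
  note U_bij = unitary_op_bij[OF U] and T_bij = unitary_op_bij[OF T]
  have \<psi>: "e (0, 0) = \<psi>" by (simp add: e_def wavelet_system_def opow_0)
  then have \<psi>_C: "\<psi> \<in> C" using e_closed[of "(0, 0)"] by simp
  have e_U: "e (j + 1, k) = U (e (j, k))" for j k
    by (simp add: e_def wavelet_system_def opow_add_1[OF U_bij] opow_closed[OF T_bij \<psi>_C])
  have e_T: "e (0, k + 1) = T (e (0, k))" for k
    by (simp add: e_def wavelet_system_def opow_0 opow_add_1[OF T_bij \<psi>_C])
  have shift_\<Theta>: "shift (\<Theta> h) = \<Theta> (U h)" if "h \<in> C" for h
  proof (rule ell2_eqI)
    fix i :: "int \<times> int"
    obtain j k where i: "i = (j, k)" by (cases i)
    show "coord (shift (\<Theta> h)) i = coord (\<Theta> (U h)) i"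
      using that e_U[of "j - 1" k] e_closed[of "(j - 1, k)"]
      by (simp add: i coord_shift coord_analysis unitary_op_closed[OF U] unitary_op_ip[OF U])
  qed
  define K where "K = \<Theta> ` C"
  define t where "t x = \<Theta> (T (inv_into C \<Theta> x))" for x
  have t_\<Theta>: "t (\<Theta> h) = \<Theta> (T h)" if "h \<in> C" for h
    unfolding t_def
    using that by (intro unitary_op_analysis_cong[OF T]) (auto intro: inv_into_into f_inv_into_f)
  have T_C: "T h \<in> C" and U_C: "U h \<in> C" if "h \<in> C" for h
    using that T U by (simp_all add: unitary_op_closed)
  have "\<exists>A. ell2.unitary A \<and> (\<forall>x. shift (A (inv shift x)) = A (A x)) \<and> (\<forall>x\<in>K. A x = t x)
    \<and> (\<forall>k. A (unit (0, k)) = unit (0, k + 1))"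
  proof (rule exists_extension_ell2)
    show "subspace K" unfolding K_def by (rule subspace_range_analysis)
    show K_i: "cmul \<i> x \<in> K" if "x \<in> K" for x
      using that by (auto simp: K_def scale_closed simp flip: analysis_scale)
    show "shift x \<in> K" if "x \<in> K" for x
      using that by (auto simp: K_def shift_\<Theta> U_C)
    show "inv shift x \<in> K" if x: "x \<in> K" for x
    proof -
      have "x \<in> \<Theta> ` U ` C"
        using x by (simp add: K_def bij_betw_imp_surj_on[OF U_bij])
      then obtain h where h: "h \<in> C" "x = \<Theta> (U h)" by blast
      then have "inv shift x = \<Theta> h" by (simp add: unitary_shift flip: shift_\<Theta>)
      then show ?thesis using h by (simp add: K_def)
    qed
    show "t (x + y) = t x + t y" if "x \<in> K" "y \<in> K" for x y
      using that by (auto simp: K_def t_\<Theta> add_closed unitary_op_add[OF T] T_C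
          simp flip: analysis_add)
    show "t (r *\<^sub>R x) = r *\<^sub>R t x" if "x \<in> K" for r x
      using that by (auto simp: K_def t_\<Theta> scale_closed unitary_op_scale[OF T] T_C
          simp flip: analysis_scaleR)
    show "t (cmul \<i> x) = cmul \<i> (t x)" if "x \<in> K" for x
      using that by (auto simp: K_def t_\<Theta> scale_closed unitary_op_scale[OF T] T_C
          simp flip: analysis_scale)
    show "norm (t x) = norm x" if "x \<in> K" for x
      using that by (auto simp: K_def t_\<Theta> norm_analysis T_C hnorm_def unitary_op_ip[OF T])
    show "t ` K = K"
    proof -
      have "t ` K = \<Theta> ` T ` C" by (simp add: K_def image_image t_\<Theta> cong: image_cong)
      then show ?thesis by (simp add: K_def bij_betw_imp_surj_on[OF T_bij])
    qed
    show "shift (t x) = t (t (shift x))" if "x \<in> K" for x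
      using that by (auto simp: K_def t_\<Theta> shift_\<Theta> T_C U_C UT)
    show "coord (t x) (0, k) = coord x (0, k - 1)" if "x \<in> K" for x k
      using that e_T[of "k - 1"]
      by (auto simp: K_def t_\<Theta> coord_analysis T_C unitary_op_ip[OF T] e_closed)
  qed
  then obtain A where A: "ell2.unitary A" and A_rel: "\<And>x. shift (A (inv shift x)) = A (A x)"
    and A_K: "\<And>x. x \<in> K \<Longrightarrow> A x = t x" and A_unit: "\<And>k. A (unit (0, k)) = unit (0, k + 1)"
    by blast
  have A_\<Theta>: "A (\<Theta> h) = \<Theta> (T h)" if "h \<in> C" for h
    using that A_K[of "\<Theta> h"] t_\<Theta> by (simp add: K_def)
  define W where "W = {w. \<forall>h\<in>C. inner (\<Theta> h) w = 0}"
  have W: "subspace W" by (simp add: W_def subspace_def inner_add_right)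
  have W_closed: "closed W"
  proof -
    have "W = (\<Inter>h\<in>C. {w. inner (\<Theta> h) w = 0})" by (auto simp: W_def)
    then show ?thesis by (auto intro!: closed_INT closed_Collect_eq continuous_intros)
  qed
  have W_i: "cmul \<i> w \<in> W" if "w \<in> W" for w
  proof -
    have "inner (\<Theta> h) (cmul \<i> w) = 0" if "h \<in> C" for h
      using inner_cmul_i_left[of "\<Theta> h" w] \<open>w \<in> W\<close> that
      by (simp add: W_def scale_closed flip: analysis_scale)
    then show ?thesis by (simp add: W_def)
  qed
  \<comment> \<open>\<open>B\<close> maps the range of \<open>\<Theta>\<close> onto itself because
    \<open>S\<close> is onto, so \<open>B\<close> and its inverse preserve the orthogonal
    complement. Used for \<open>shift\<close> with \<open>U\<close> and for \<open>A\<close> with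
    \<open>T\<close>.\<close>
  have W_invariant: "B w \<in> W" "inv B w \<in> W"
    if B: "ell2.unitary B" "unitary_op H S" "\<And>h. h \<in> C \<Longrightarrow> B (\<Theta> h) = \<Theta> (S h)" and w: "w \<in> W"
    for B S w
  proof -
    have "inner (\<Theta> h) (inv B w) = 0" if "h \<in> C" for h
      using that w B(2,3) ell2.unitary_inner_inv[OF B(1), of "\<Theta> h" w]
      by (simp add: W_def unitary_op_closed)
    then show "inv B w \<in> W" by (simp add: W_def)
    have "inner (\<Theta> h) (B w) = 0" if h: "h \<in> C" for h
    proof -
      obtain h' where "h' \<in> C" "h = S h'"
        using bij_betw_imp_surj_on[OF unitary_op_bij[OF B(2)]] h by blast
      then show ?thesis using w by (simp add: ell2.unitary_inner[OF B(1)] W_def flip: B(3))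
    qed
    then show "B w \<in> W" by (simp add: W_def)
  qed
  note W_shift = W_invariant[OF unitary_shift U shift_\<Theta>] and W_A = W_invariant[OF A T A_\<Theta>]
  \<comment> \<open>\<open>unit i\<close> and \<open>\<Theta> (e i)\<close> have the same inner
    product with every \<open>\<Theta> h\<close>, so \<open>g i\<close> is the orthogonal projection
    of \<open>unit i\<close> onto \<open>W\<close>.\<close>
  define g where "g i = unit i - \<Theta> (e i)" for i
  have g_W: "g i \<in> W" for i
    by (simp add: W_def g_def inner_diff_right inner_unit coord_analysis inner_analysis e_closed)
  have cip_W: "cip w (\<Theta> h) = 0" if "w \<in> W" "h \<in> C" for w h
    using that W_i[OF that(1)]
    by (simp add: W_def cip_def inner_commute[of w] inner_cmul_i_left complex_eq_iff)
  \<comment> \<open>The coefficients of \<open>w\<close> against the family \<open>g\<close> are its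
    own coordinates, which makes \<open>g\<close> a Parseval frame of \<open>W\<close>.\<close>
  have cip_g: "cip w (g i) = coord w i" if "w \<in> W" for w i
    by (simp add: g_def cip_diff_right cip_unit cip_W that e_closed)
  define H2 where "H2 = sub_ell2 W"
  define U2 where "U2 f = coord (shift (of_coords f))" for f
  define T2 where "T2 f = coord (A (of_coords f))" for f
  have H2: "complex_hilbert_space H2"
    unfolding H2_def by (rule complex_hilbert_space_sub_ell2[OF W W_closed W_i])
  have "unitary_op H2 U2" "unitary_op H2 T2"
    unfolding H2_def U2_def[abs_def] T2_def[abs_def]
    by (intro unitary_op_sub_ell2 unitary_shift A W_shift W_A; assumption)+
  moreover have "shift (A x) = A (A (shift x))" for x
    using A_rel[of "shift x"] by (simp add: unitary_shift)
  ultimately have rep2: "bs12_rep H2 U2 T2"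
    unfolding bs12_rep_iff by (simp add: U2_def T2_def coord_inverse)
  have bij2: "bij_betw U2 (hcarrier H2) (hcarrier H2)" "bij_betw T2 (hcarrier H2) (hcarrier H2)"
    using rep2 by (simp_all add: bs12_rep_iff unitary_op_bij)
  have g_rec: "shift (g (j, k)) = g (j + 1, k)" "A (g (0, k)) = g (0, k + 1)" for j k
    by (simp_all add: g_def linear_diff ell2.unitary_linear unitary_shift A shift_unit A_unit
        shift_\<Theta> A_\<Theta> e_closed e_U e_T)
  have sys2: "wavelet_system H2 U2 T2 (coord (g (0, 0))) = (\<lambda>i. coord (g i))"
    by (rule wavelet_system_unique[OF bij2])
      (simp_all add: H2_def sub_ell2_simps g_W U2_def T2_def coord_inverse g_rec)
  have "parseval_wavelet H2 U2 T2 (coord (g (0, 0)))"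
    unfolding parseval_wavelet_def parseval_frame_def sys2
    by (auto simp: H2_def sub_ell2_simps g_W cip_g intro: has_sum_norm_ell2)
  moreover have rep: "bs12_rep (hsum H H2) (opsum U U2) (opsum T T2)"
    by (rule bs12_rep_opsum[OF assms(2) rep2])
  moreover have "orthonormal_wavelet (hsum H H2) (opsum U U2) (opsum T T2) (\<psi>, coord (g (0, 0)))"
  proof -
    have "bij_betw (opsum U U2) (hcarrier (hsum H H2)) (hcarrier (hsum H H2))"
      "bij_betw (opsum T T2) (hcarrier (hsum H H2)) (hcarrier (hsum H H2))"
      using rep by (simp_all add: bs12_rep_iff unitary_op_bij)
    from wavelet_system_unique[OF this, of "\<lambda>i. (e i, coord (g i))"]
    have sys: "wavelet_system (hsum H H2) (opsum U U2) (opsum T T2) (e (0, 0), coord (g (0, 0)))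
        = (\<lambda>i. (e i, coord (g i)))"
      by (simp add: hsum_def opsum_def e_closed e_U e_T H2_def sub_ell2_simps g_W U2_def T2_def
          coord_inverse g_rec)
    \<comment> \<open>By \<open>cip_g\<close> the second term is coordinate j of \<open>g i\<close>,
      that is the Kronecker delta minus the first term.\<close>
    have orthonormal: "hip H (e i) (e j) + cip (g i) (g j) = (if i = j then 1 else 0)" for i j
      by (simp add: cip_g[OF g_W]) (simp add: g_def coord_unit coord_analysis e_closed)
    \<comment> \<open>The vanishing sums are the coordinates of \<open>\<Theta> f + x\<close>. Its
      two summands are orthogonal, so both are zero.\<close>
    have total: "f = hzero H \<and> x = 0"
      if "f \<in> C" "x \<in> W" and orth: "\<And>i. hip H f (e i) + cip x (g i) = 0" for f x
    proof -
      have "\<Theta> f + x = 0"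
        by (rule ell2_eqI) (use that in \<open>simp add: coord_analysis cip_g\<close>)
      then have x: "x = - \<Theta> f" by (simp add: eq_neg_iff_add_eq_0 add.commute)
      then have "\<Theta> f = 0" using that by (auto simp: W_def)
      with x show ?thesis using analysis_eq_0[OF that(1)] by simp
    qed
    show ?thesis
      unfolding orthonormal_wavelet_def orthonormal_basis_def \<psi>[symmetric] sys
    proof (intro conjI allI ballI impI)
      show "(e i, coord (g i)) \<in> hcarrier (hsum H H2)" for i
        by (simp add: hsum_def e_closed H2_def sub_ell2_simps g_W)
      show "hip (hsum H H2) (e i, coord (g i)) (e j, coord (g j)) = (if i = j then 1 else 0)" for i j
        using orthonormal by (simp add: hsum_def H2_def sub_ell2_simps)
      show "p = hzero (hsum H H2)"
        if p: "p \<in> hcarrier (hsum H H2)" and orth: "\<forall>i. hip (hsum H H2) p (e i, coord (g i)) = 0" for p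
      proof -
        obtain f x where fx: "p = (f, coord x)" "f \<in> C" "x \<in> W"
          using p by (auto simp: hsum_def H2_def sub_ell2_simps)
        have "hip H f (e i) + cip x (g i) = 0" for i
          using orth[THEN spec, of i] by (simp add: fx(1) hsum_def H2_def sub_ell2_simps)
        from total[OF fx(2,3) this] show ?thesis by (simp add: fx(1) hsum_def H2_def sub_ell2_simps)
      qed
    qed
  qed
  ultimately show ?thesis using H2 rep2 by blast
qed

end
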